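(* Let $n>1$ and $m\ge 1$ be integers. Assume that $a(x), f_i(x) \in C^{\infty}(\mathbb{R}^n)$, $i=1,\ldots,m$, and $V(z) \in C^\infty(\mathbb{R}^m)$. In addition, assume that there exist constants $0<a_0\leq a_1$ and $M>0$ such that $a_0 \leq a(x) \leq a_1$ and $|f_i(x)|, |Da(x)|, |Df_i(x)| \leq M$ for all $x \in \mathbb{R}^n$ and $i=1,\ldots,m$. Assume also that, for each $i=1,\ldots,m$, $$\lim_{z_i \to \infty} V_{z_i}(z) = \infty, \qquad \lim_{z_i \to -\infty} V_{z_i}(z) = -\infty, \qquad \text{uniformly in all } z_j,\ j \neq i,$$ and $$a(x) V(z) + \sum_{i=1}^m z_i f_i(x) \geq -f_0(x)$$ for all $x \in \mathbb{R}^n$, $z \in \mathbb{R}^m$ and some function $f_0(x)>0$ satisfying $\int_{\mathbb{R}^n} f_0(x)\,dx < \infty$. Then the system $$\Delta u_i - a(x) V_{z_i}(u) = f_i(x), \qquad i=1,\ldots,m, \quad x\in\mathbb{R}^n,$$ has a uniformly bounded classical solution $u(x)=(u_1(x),\ldots,u_m(x))$, with $u_i(x) \in C^2(\mathbb{R}^n)$, $i=1,\ldots,m$.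
   Context: $V_{z_i}$ denotes the partial derivative $\partial V/\partial z_i$, and $Da$, $Df_i$ denote gradients. All functions are real-valued (or $\mathbb{R}^m$-valued for $u$). Uniformly bounded means bounded on all of $\mathbb{R}^n$. *)

theory Defs
  imports "HOL-Analysis.Analysis"
begin

definition partial_deriv :: "'n::finite \<Rightarrow> (real ^ 'n \<Rightarrow> real) \<Rightarrow> real ^ 'n \<Rightarrow> real" where
  "partial_deriv i f x = deriv (\<lambda>t. f (x + t *\<^sub>R axis i 1)) 0"

text \<open>The clause on differentiability guarantees that the first partial derivatives exist, so that
  \<open>partial_deriv\<close> is never an arbitrary value of \<open>deriv\<close>; it is implied by, and hence
  adds nothing to, the existence and continuity of these partial derivatives.\<close>

primrec C_k :: "nat \<Rightarrow> (real ^ 'n::finite \<Rightarrow> real) \<Rightarrow> bool" where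
  "C_k 0 f \<longleftrightarrow> continuous_on UNIV f"
| "C_k (Suc k) f \<longleftrightarrow> f differentiable_on UNIV \<and> (\<forall>i. C_k k (partial_deriv i f))"

definition C_infinity :: "(real ^ 'n::finite \<Rightarrow> real) \<Rightarrow> bool" where
  "C_infinity f \<longleftrightarrow> (\<forall>k. C_k k f)"

definition grad :: "(real ^ 'n::finite \<Rightarrow> real) \<Rightarrow> real ^ 'n \<Rightarrow> real ^ 'n" where
  "grad f x = (\<chi> i. partial_deriv i f x)"

definition laplacian :: "(real ^ 'n::finite \<Rightarrow> real) \<Rightarrow> real ^ 'n \<Rightarrow> real" where
  "laplacian f x = (\<Sum>i\<in>UNIV. partial_deriv i (partial_deriv i f) x)"

end

theory Submission
  imports Defs "HOL-Probability.Distributions" "HOL-Complex_Analysis.Great_Picard"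
begin

text \<open>Choose a cube \<open>[-R, R]\<^sup>m\<close> such that \<open>a V\<^sub>i + f\<^sub>i\<close> is nonnegative on the face
  \<open>z\<^sub>i = R\<close> and nonpositive on the face \<open>z\<^sub>i = -R\<close>. For a large constant \<open>l\<close> the function
  \<open>h\<^sub>i = z\<^sub>i - (a V\<^sub>i + f\<^sub>i) / l\<close> then maps the cube into \<open>[-R, R]\<close>, and the system reads
  \<open>u\<^sub>i = l (l - \<Delta>)\<inverse> h\<^sub>i(x, u)\<close>. Since \<open>l (l - \<Delta>)\<inverse>\<close> averages against a probability
  kernel, the right-hand side preserves the functions with values in the cube, and it turns bounded
  functions into uniformly Lipschitz ones. Discretising in the values of \<open>u\<close> at finitely many points
  of a dense set gives self-maps of finite-dimensional cubes, whose approximate fixed points converge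
  to a fixed point by equicontinuity and dominated convergence. One resolvent makes the
  fixed point \<open>C\<^sup>1\<close>, hence also \<open>h\<^sub>i(x, u)\<close>, and a second application makes it \<open>C\<^sup>2\<close>.\<close>

section \<open>Gaussian integrals\<close>

text \<open>Bounded functions on R^n carry no compactness in the supremum norm, so the fixed point
  is reached through pointwise limits only; dominated convergence under the resolvent integral makes
  these sufficient. The discretised functions are step functions, hence the Lipschitz bound of the
  resolvent must hold for merely measurable right-hand sides. This forces the first derivative onto
  the Gaussian factor, where it creates a singularity 1/s; the Jacobian of the substitution that
  replaces time by a radial variable s cancels it. In this form each application of the resolvent
  gains one derivative: a bounded continuous right-hand side gives C^1, and second derivatives
  require a right-hand side with bounded continuous gradient. There the bounds on Da and Df_i enter,
  together with bounds for the derivatives of V on the cube. The constant \<open>l\<close> exceeds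
  the upper bound of \<open>a\<close> times a bound for the second derivatives of V on the cube.
  Thus l z_i - a V_i(z) is nondecreasing in z_i there, and its extremes along z_i lie on the two
  faces where the sign conditions hold.\<close>

lemma integrable_gaussian_real:
  assumes "0 < (c::real)" shows "integrable lborel (\<lambda>x::real. exp (- (c * x\<^sup>2)))"
proof -
  define \<sigma> where "\<sigma> = 1 / sqrt (2 * c)"
  have s: "\<sigma>\<^sup>2 = 1 / (2 * c)" using assms by (simp add: \<sigma>_def power_divide)
  have "integrable lborel (\<lambda>x. sqrt (2 * pi * \<sigma>\<^sup>2) * normal_density 0 \<sigma> x)"
    by (intro integrable_mult_right integrable_normal_density) (use assms in \<open>simp add: \<sigma>_def\<close>)
  moreover have "sqrt (2 * pi * \<sigma>\<^sup>2) * normal_density 0 \<sigma> x = exp (- (c * x\<^sup>2))" for x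
    using assms by (simp add: normal_density_def s)
  ultimately show ?thesis by simp
qed

text \<open>The inner product splits over \<open>Basis\<close>, so the integrand is a product of
  one-variable Gaussians and its integral a finite power of a finite number.\<close>

lemma integrable_gaussian:
  assumes "0 < (c::real)"
  shows "integrable lborel (\<lambda>x::'a::euclidean_space. exp (- (c * (x \<bullet> x))))"
proof (rule integrableI_bounded)
  have *: "(\<integral>\<^sup>+x. ennreal (exp (- (c * x\<^sup>2))) \<partial>lborel) < \<infinity>"
    using integrable_gaussian_real[OF assms] by (simp add: integrable_iff_bounded)
  have "(\<integral>\<^sup>+x. ennreal (norm (exp (- (c * (x \<bullet> x))))) \<partial>(lborel::'a measure))
      = (\<integral>\<^sup>+x. (\<Prod>b\<in>Basis. ennreal (exp (- (c * (x \<bullet> b)\<^sup>2)))) \<partial>(lborel::'a measure))"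
  proof (rule nn_integral_cong)
    fix x :: 'a
    have "x \<bullet> x = (\<Sum>b\<in>Basis. (x \<bullet> b)\<^sup>2)"
      by (subst euclidean_inner) (simp add: power2_eq_square)
    then show "ennreal (norm (exp (- (c * (x \<bullet> x))))) = (\<Prod>b\<in>Basis. ennreal (exp (- (c * (x \<bullet> b)\<^sup>2))))"
      by (simp add: prod_ennreal prod_nonneg exp_sum sum_distrib_left flip: sum_negf)
  qed
  also have "\<dots> = (\<Prod>b\<in>(Basis::'a set). \<integral>\<^sup>+x. ennreal (exp (- (c * x\<^sup>2))) \<partial>lborel)"
    by (subst nn_integral_lborel_prod) auto
  also have "\<dots> < \<infinity>" using * by (simp add: power_less_top_ennreal)
  finally show "(\<integral>\<^sup>+x. ennreal (norm (exp (- (c * (x \<bullet> x))))) \<partial>(lborel::'a measure)) < \<infinity>" .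
qed simp

text \<open>Half of the exponent absorbs the growth of \<open>norm x\<close>: with \<open>y\<close>
  equal to that half, \<open>norm x\<close> is at most a constant times
  \<open>exp y\<close>.\<close>

lemma integrable_norm_gaussian:
  assumes "0 < (c::real)"
  shows "integrable lborel (\<lambda>x::'a::euclidean_space. norm x * exp (- (c * (x \<bullet> x))))"
proof (rule Bochner_Integration.integrable_bound)
  show "integrable lborel (\<lambda>x::'a. (1 + 2 / c) * exp (- (c / 2 * (x \<bullet> x))))"
    using assms by (intro integrable_mult_right integrable_gaussian) simp
  show "AE x in lborel. norm (norm x * exp (- (c * (x \<bullet> x)))) \<le> norm ((1 + 2 / c) * exp (- (c / 2 * (x \<bullet> (x::'a)))))"
  proof (intro AE_I2)
    fix x :: 'a
    define y where "y = c / 2 * (x \<bullet> x)"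
    have y0: "y \<ge> 0" using assms by (simp add: y_def)
    have "norm x \<le> 1 + (norm x)\<^sup>2"
      using sum_squares_bound[of "norm x" 1] by (simp add: power2_eq_square) (smt (verit) norm_ge_zero)
    also have "\<dots> = 1 + 2 / c * y" using assms by (simp add: y_def power2_norm_eq_inner)
    also have "\<dots> \<le> (1 + 2 / c) * exp y"
    proof -
      have "y \<le> exp y" using exp_ge_add_one_self[of y] by linarith
      then have "2 / c * y \<le> 2 / c * exp y" using assms by (intro mult_left_mono) auto
      moreover have "1 \<le> exp y" using y0 by simp
      ultimately show ?thesis by (metis add_mono distrib_right mult_1)
    qed
    finally have "norm x * exp (- 2 * y) \<le> (1 + 2 / c) * exp y * exp (- 2 * y)"
      by (intro mult_right_mono) auto
    also have "\<dots> = (1 + 2 / c) * exp (- y)" by (simp add: mult.assoc flip: exp_add)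
    finally show "norm (norm x * exp (- (c * (x \<bullet> x)))) \<le> norm ((1 + 2 / c) * exp (- (c / 2 * (x \<bullet> x))))"
      using assms by (simp add: y_def)
  qed
qed simp

section \<open>Fubini and translation invariance for Lebesgue measure\<close>

lemma integrable_lborel_times:
  fixes f :: "'a::euclidean_space \<Rightarrow> real" and g :: "'b::euclidean_space \<Rightarrow> real"
  assumes [measurable]: "integrable lborel f" "integrable lborel g"
  shows "integrable lborel (\<lambda>p. f (fst p) * g (snd p))"
proof -
  have [measurable]: "f \<in> borel_measurable borel" "g \<in> borel_measurable borel"
    using assms[THEN borel_measurable_integrable] by simp_all
  have "integrable (lborel \<Otimes>\<^sub>M lborel) (\<lambda>p. f (fst p) * g (snd p))"
    by (rule lborel_pair.Fubini_integrable) (auto simp: abs_mult assms intro!: integrable_mult_right integrable_mult_left integrable_abs)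
  then show ?thesis by (simp add: lborel_prod)
qed

lemma integral_lborel_fst:
  fixes f :: "'a::euclidean_space \<times> 'b::euclidean_space \<Rightarrow> 'c::euclidean_space"
  assumes "integrable lborel f"
  shows "(\<integral>p. f p \<partial>lborel) = (\<integral>x. (\<integral>y. f (x, y) \<partial>lborel) \<partial>lborel)"
  using lborel_pair.integral_fst'[of f] assms by (simp add: lborel_prod)

lemma integral_lborel_snd:
  fixes f :: "'a::euclidean_space \<times> 'b::euclidean_space \<Rightarrow> 'c::euclidean_space"
  assumes "integrable lborel f"
  shows "(\<integral>p. f p \<partial>lborel) = (\<integral>y. (\<integral>x. f (x, y) \<partial>lborel) \<partial>lborel)"
  using lborel_pair.integral_snd[of "curry f"] assms by (simp add: lborel_prod curry_def)

lemma integral_lborel_translation: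
  fixes f :: "'a::euclidean_space \<Rightarrow> 'b::euclidean_space"
  assumes [measurable]: "f \<in> borel_measurable borel"
  shows "(\<integral>x. f (c + x) \<partial>lborel) = (\<integral>x. f x \<partial>lborel)"
  by (subst (2) lborel_distr_plus[of c, symmetric]) (simp add: integral_distr)

lemma integrable_lborel_translation:
  fixes f :: "'a::euclidean_space \<Rightarrow> 'b::euclidean_space"
  assumes [measurable]: "f \<in> borel_measurable borel"
  shows "integrable lborel (\<lambda>x. f (c + x)) \<longleftrightarrow> integrable lborel f"
  by (subst (2) lborel_distr_plus[of c, symmetric]) (simp add: integrable_distr_eq)

section \<open>The resolvent of the Laplacian\<close>

lemma fst_borel_measurable [measurable]:
    "fst \<in> borel_measurable (borel :: ('a::second_countable_topology \<times> 'b::second_countable_topology) measure)"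
  and snd_borel_measurable [measurable]:
    "snd \<in> borel_measurable (borel :: ('a \<times> 'b) measure)"
  by (simp_all add: borel_prod[symmetric])

lemma norm_mult_le_bound:
  fixes c :: real
  assumes "0 \<le> c" "\<bar>x\<bar> \<le> B"
  shows "norm (c * x) \<le> norm (B * c)"
  using mult_left_mono[OF order_trans[OF assms(2) abs_ge_self] assms(1)] assms(1)
  by (simp add: abs_mult mult.commute)

text \<open>Left unnormalised: the value of the Gaussian integral is never computed, since it
  cancels against \<open>mass\<close>.\<close>

definition gauss :: "'a::euclidean_space \<Rightarrow> real" where
  "gauss z = exp (- (1 / 2 * (z \<bullet> z)))"

lemma gauss_measurable [measurable]: "gauss \<in> borel_measurable borel"
  unfolding gauss_def by measurable

lemma gauss_pos [simp]: "0 < gauss z" and gauss_nonneg [simp]: "0 \<le> gauss z"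
  by (simp_all add: gauss_def)

lemma integrable_gauss: "integrable lborel (gauss :: 'a::euclidean_space \<Rightarrow> real)"
  unfolding gauss_def by (intro integrable_gaussian) simp

lemma integrable_norm_gauss: "integrable lborel (\<lambda>z::'a::euclidean_space. norm z * gauss z)"
  unfolding gauss_def by (intro integrable_norm_gaussian) simp

lemma integral_gauss_pos: "0 < (\<integral>z. gauss (z::'a::euclidean_space) \<partial>lborel)"
proof -
  have "(\<integral>z. gauss (z::'a) \<partial>lborel) \<noteq> 0"
  proof
    assume "(\<integral>z. gauss (z::'a) \<partial>lborel) = 0"
    then have "AE z in lborel. gauss (z::'a) = 0"
      by (subst (asm) integral_nonneg_eq_0_iff_AE[OF integrable_gauss]) auto
    then have "AE z in (lborel::'a measure). False"
      by eventually_elim (metis gauss_pos less_irrefl)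
    then show False by (simp add: AE_iff_null null_sets_def space_lborel)
  qed
  moreover have "0 \<le> (\<integral>z. gauss (z::'a) \<partial>lborel)" by simp
  ultimately show ?thesis by linarith
qed

locale yukawa =
  fixes l :: real
  assumes l_pos: "0 < l"
begin

text \<open>The Jacobian \<open>s\<close> is kept out of \<open>k\<close> because both weights
  \<open>s * k s\<close> and \<open>k s\<close> occur, one in the resolvent and one in its gradient.
  The indicator lets all integrals run over the whole line.\<close>

definition k :: "real \<Rightarrow> real" where
  "k s = indicator {0<..} s * exp (- (l / 2 * s\<^sup>2))"

lemma k_measurable [measurable]: "k \<in> borel_measurable borel"
  unfolding k_def by measurable

lemma k_nonneg [simp]: "0 \<le> k s" and k_times_nonneg [simp]: "0 \<le> s * k s"
  by (auto simp: k_def indicator_def)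

lemma integrable_k: "integrable lborel k"
proof (rule Bochner_Integration.integrable_bound)
  show "integrable lborel (\<lambda>s::real. exp (- (l / 2 * s\<^sup>2)))"
    using l_pos by (intro integrable_gaussian_real) simp
qed (auto simp: k_def indicator_def)

lemma integrable_times_k: "integrable lborel (\<lambda>s. s * k s)"
proof (rule Bochner_Integration.integrable_bound)
  show "integrable lborel (\<lambda>s::real. norm s * exp (- (l / 2 * (s \<bullet> s))))"
    using l_pos by (intro integrable_norm_gaussian) simp
qed (auto simp: k_def indicator_def power2_eq_square)

text \<open>On the positive axis \<open>k\<close> has derivative \<open>- l * s * k s\<close>, which
  links the two weights. Boundedness of \<psi> removes the boundary term at infinity; the one at 0
  survives and later becomes the term \<open>- h x\<close> of the resolvent equation.\<close>

lemma k_by_parts: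
  assumes \<psi>: "\<And>s. (\<psi> has_real_derivative \<psi>' s) (at s)"
    and cont: "continuous_on UNIV \<psi>'"
    and B: "\<And>s. \<bar>\<psi> s\<bar> \<le> B" "\<And>s. \<bar>\<psi>' s\<bar> \<le> B'"
  shows "(\<integral>s. k s * \<psi>' s \<partial>lborel) = l * (\<integral>s. s * k s * \<psi> s \<partial>lborel) - \<psi> 0"
proof -
  have c\<psi>: "continuous_on UNIV \<psi>"
    using \<psi> by (meson DERIV_isCont continuous_at_imp_continuous_on)
  have [measurable]: "\<psi> \<in> borel_measurable borel" "\<psi>' \<in> borel_measurable borel"
    using c\<psi> cont by (auto intro: borel_measurable_continuous_onI)
  have i1: "integrable lborel (\<lambda>s. k s * \<psi>' s)"
  proof (rule Bochner_Integration.integrable_bound)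
    show "integrable lborel (\<lambda>s. B' * k s)" by (intro integrable_mult_right integrable_k)
    show "AE s in lborel. norm (k s * \<psi>' s) \<le> norm (B' * k s)"
      by (intro AE_I2 norm_mult_le_bound B k_nonneg)
  qed simp
  have i2: "integrable lborel (\<lambda>s. s * k s * \<psi> s)"
  proof (rule Bochner_Integration.integrable_bound)
    show "integrable lborel (\<lambda>s. B * (s * k s))" by (intro integrable_mult_right integrable_times_k)
    show "AE s in lborel. norm (s * k s * \<psi> s) \<le> norm (B * (s * k s))"
      by (intro AE_I2 norm_mult_le_bound B k_times_nonneg)
  qed simp
  \<comment> \<open>\<open>F\<close> and \<open>F'\<close> drop the indicator of \<open>k\<close>
    and are therefore regular across 0; \<open>ind\<close> restores it on the interval of
    integration.\<close>
  define F where "F s = exp (- (l / 2 * s\<^sup>2)) * \<psi> s" for s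
  define F' where "F' s = exp (- (l / 2 * s\<^sup>2)) * \<psi>' s - l * (s * exp (- (l / 2 * s\<^sup>2)) * \<psi> s)" for s
  have ind: "indicator {0<..} s * F' s = k s * \<psi>' s - l * (s * k s * \<psi> s)" for s
    by (auto simp: F'_def k_def indicator_def)
  have ein: "einterval 0 \<infinity> = {0<..}" by (auto simp: einterval_def)
  have "(LBINT s=0..\<infinity>. F' s) = 0 - \<psi> 0"
  proof (rule interval_integral_FTC_integrable)
    show "(F has_vector_derivative F' s) (at s)" for s
      unfolding F_def F'_def has_real_derivative_iff_has_vector_derivative[symmetric]
      by (auto intro!: derivative_eq_intros \<psi> simp: algebra_simps)
    show "isCont F' s" for s
    proof -
      have "continuous_on UNIV F'" unfolding F'_def by (intro continuous_intros cont c\<psi>)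
      then show ?thesis by (simp add: continuous_on_eq_continuous_at)
    qed
    show "set_integrable lborel (einterval 0 \<infinity>) F'"
      unfolding set_integrable_def ein real_scaleR_def ind
      by (intro Bochner_Integration.integrable_diff integrable_mult_right i1 i2)
    have "(F \<longlongrightarrow> F 0) (at_right 0)"
    proof -
      have "continuous_on UNIV F" unfolding F_def by (intro continuous_intros c\<psi>)
      then have "isCont F 0" by (simp add: continuous_on_eq_continuous_at)
      then show ?thesis by (simp add: isCont_def filterlim_at_split)
    qed
    then show "((F \<circ> real_of_ereal) \<longlongrightarrow> \<psi> 0) (at_right 0)"
      by (simp add: zero_ereal_def ereal_tendsto_simps F_def)
    have "(F \<longlongrightarrow> 0) at_top"
    proof (rule tendsto_0_le)
      have "filterlim (\<lambda>s. l / 2 * s\<^sup>2) at_top at_top"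
        using l_pos by (intro filterlim_tendsto_pos_mult_at_top[OF tendsto_const] filterlim_pow_at_top filterlim_ident) auto
      then show "((\<lambda>s. exp (- (l / 2 * s\<^sup>2))) \<longlongrightarrow> 0) at_top"
        by (intro filterlim_compose[OF exp_at_bot]) (simp add: filterlim_uminus_at_bot)
      show "\<forall>\<^sub>F s in at_top. norm (F s) \<le> norm (exp (- (l / 2 * s\<^sup>2))) * B"
        using B(1) by (intro always_eventually) (auto simp: F_def abs_mult)
    qed
    then show "((F \<circ> real_of_ereal) \<longlongrightarrow> 0) (at_left \<infinity>)"
      by (simp add: ereal_tendsto_simps)
  qed simp
  moreover have "(LBINT s=0..\<infinity>. F' s) = (\<integral>s. k s * \<psi>' s - l * (s * k s * \<psi> s) \<partial>lborel)"
    by (simp add: interval_lebesgue_integral_def set_lebesgue_integral_def ein ind)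
  moreover have "\<dots> = (\<integral>s. k s * \<psi>' s \<partial>lborel) - l * (\<integral>s. s * k s * \<psi> s \<partial>lborel)"
    by (subst Bochner_Integration.integral_diff) (auto intro: i1 i2)
  ultimately show ?thesis by simp
qed

lemma integral_times_k: "(\<integral>s. s * k s \<partial>lborel) = 1 / l"
  using k_by_parts[of "\<lambda>_. 1" "\<lambda>_. 0" 1 0] l_pos by (simp add: field_simps)

text \<open>\<open>(l - \<Delta>)\<inverse> = \<integral>\<^sub>0\<^sup>\<infinity> exp (- l t) exp (t \<Delta>) dt\<close> turns under \<open>t = s\<^sup>2 / 2\<close> into an average of \<open>h (x + s z)\<close>
  with the weight \<open>kernel\<close>; moving a derivative from \<open>h\<close> to the Gaussian costs a factor
  \<open>z / s\<close>, which gives \<open>kernel'\<close>.\<close>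

definition kernel :: "real \<times> 'a::euclidean_space \<Rightarrow> real" where
  "kernel p = fst p * k (fst p) * gauss (snd p)"

definition kernel' :: "real \<times> 'a::euclidean_space \<Rightarrow> real" where
  "kernel' p = k (fst p) * gauss (snd p)"

lemma kernel_nonneg [simp]: "0 \<le> kernel p" and kernel'_nonneg [simp]: "0 \<le> kernel' p"
  by (simp_all add: kernel_def kernel'_def)

lemma kernel_measurable [measurable]: "kernel \<in> borel_measurable borel"
  unfolding kernel_def by measurable

lemma kernel'_measurable [measurable]: "kernel' \<in> borel_measurable borel"
  unfolding kernel'_def by measurable

lemma integrable_kernel: "integrable lborel kernel"
  unfolding kernel_def
  using integrable_lborel_times[OF integrable_times_k integrable_gauss] by simp

lemma integrable_kernel': "integrable lborel (\<lambda>p. kernel' p * norm (snd p))"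
  unfolding kernel'_def
  using integrable_lborel_times[OF integrable_k integrable_norm_gauss] by (simp add: mult_ac)

definition mass :: "'a::euclidean_space itself \<Rightarrow> real" where
  "mass _ = (\<integral>p. kernel (p :: real \<times> 'a) \<partial>lborel)"

lemma integral_kernel: "(\<integral>p. kernel (p :: real \<times> 'a) \<partial>lborel) = mass TYPE('a::euclidean_space)"
  by (simp add: mass_def)

text \<open>Fubini with the radial integral 1 / l. This relation makes the coefficients of
  \<open>res h x\<close> and \<open>h x\<close> agree in \<open>grad_res_divergence\<close>.\<close>

lemma mass_eq: "l * mass TYPE('a) = (\<integral>z. gauss (z :: 'a::euclidean_space) \<partial>lborel)"
  unfolding mass_def using l_pos
  by (subst integral_lborel_fst[OF integrable_kernel]) (simp add: kernel_def integral_times_k)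

lemma mass_pos: "0 < mass TYPE('a::euclidean_space)"
  using mass_eq[where 'a='a] integral_gauss_pos[where 'a='a] l_pos by (metis zero_less_mult_pos)

text \<open>Division by \<open>mass\<close> supplies both the Gaussian normalisation and the factor
  l, so this is l times the inverse of l - \<Delta>.\<close>

definition res :: "('a::euclidean_space \<Rightarrow> real) \<Rightarrow> 'a \<Rightarrow> real" where
  "res h x = (\<integral>p. kernel p * h (x + fst p *\<^sub>R snd p) \<partial>lborel) / mass TYPE('a)"

text \<open>Candidate for the gradient of \<open>res h\<close>, with the derivative falling on the
  Gaussian; it makes sense for bounded measurable \<open>h\<close>.\<close>

definition grad_res :: "('a::euclidean_space \<Rightarrow> real) \<Rightarrow> 'a \<Rightarrow> 'a" where
  "grad_res h x = (\<integral>p. (kernel' p * h (x + fst p *\<^sub>R snd p)) *\<^sub>R snd p \<partial>lborel) /\<^sub>R mass TYPE('a)"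

definition lip_const :: "'a::euclidean_space itself \<Rightarrow> real" where
  "lip_const _ = (\<integral>p. kernel' p * norm (snd (p :: real \<times> 'a)) \<partial>lborel) / mass TYPE('a)"

lemma lip_const_nonneg [simp]: "0 \<le> lip_const TYPE('a::euclidean_space)"
  unfolding lip_const_def using mass_pos[where 'a='a] by (intro divide_nonneg_pos) auto

lemma res_integrable:
  fixes h :: "'a::euclidean_space \<Rightarrow> real"
  assumes [measurable]: "h \<in> borel_measurable borel" and B: "\<And>x. \<bar>h x\<bar> \<le> B"
  shows "integrable lborel (\<lambda>p. kernel p * h (x + fst p *\<^sub>R snd p))"
proof (rule Bochner_Integration.integrable_bound)
  show "integrable lborel (\<lambda>p :: real \<times> 'a. B * kernel p)" by (intro integrable_mult_right integrable_kernel)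
  show "AE p in lborel. norm (kernel p * h (x + fst p *\<^sub>R snd p)) \<le> norm (B * kernel p)"
    by (intro AE_I2 norm_mult_le_bound B kernel_nonneg)
qed simp

lemma grad_res_norm_bound:
  assumes B: "\<And>x. \<bar>h x\<bar> \<le> B"
  shows "norm ((kernel' p * h (x + fst p *\<^sub>R snd p)) *\<^sub>R snd p) \<le> B * (kernel' p * norm (snd p))"
proof -
  have "kernel' p * norm (snd p) * \<bar>h (x + fst p *\<^sub>R snd p)\<bar> \<le> kernel' p * norm (snd p) * B"
    by (intro mult_left_mono B) simp
  then show ?thesis by (simp add: abs_mult mult_ac)
qed

lemma grad_res_integrable:
  fixes h :: "'a::euclidean_space \<Rightarrow> real"
  assumes [measurable]: "h \<in> borel_measurable borel" and B: "\<And>x. \<bar>h x\<bar> \<le> B"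
  shows "integrable lborel (\<lambda>p. (kernel' p * h (x + fst p *\<^sub>R snd p)) *\<^sub>R snd p)"
proof (rule Bochner_Integration.integrable_bound)
  show "integrable lborel (\<lambda>p :: real \<times> 'a. B * (kernel' p * norm (snd p)))"
    by (intro integrable_mult_right integrable_kernel')
  show "AE p in lborel. norm ((kernel' p * h (x + fst p *\<^sub>R snd p)) *\<^sub>R snd p) \<le> norm (B * (kernel' p * norm (snd p)))"
    unfolding real_norm_def by (intro AE_I2 order_trans[OF grad_res_norm_bound[of h, OF B] abs_ge_self])
qed simp

text \<open>The kernel is nonnegative and \<open>res\<close> divides by its total mass, so
  \<open>res\<close> is a contraction in the supremum norm. The bounds \<open>B\<close> and
  \<open>B'\<close> provide integrability; the estimate itself involves \<open>d\<close>
  alone.\<close>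

lemma res_diff_bound:
  fixes h :: "'a::euclidean_space \<Rightarrow> real"
  assumes [measurable]: "h \<in> borel_measurable borel" "g \<in> borel_measurable borel"
    and B: "\<And>x. \<bar>h x\<bar> \<le> B" "\<And>x. \<bar>g x\<bar> \<le> B'" and d: "\<And>x. \<bar>h x - g x\<bar> \<le> d"
  shows "\<bar>res h x - res g x\<bar> \<le> d"
proof -
  note ih = res_integrable[of h B x, OF assms(1) B(1)] and ig = res_integrable[of g B' x, OF assms(2) B(2)]
  have "res h x - res g x = (\<integral>p. kernel p * (h (x + fst p *\<^sub>R snd p) - g (x + fst p *\<^sub>R snd p)) \<partial>lborel) / mass TYPE('a)"
    unfolding res_def using Bochner_Integration.integral_diff[OF ih ig]
    by (simp add: right_diff_distrib diff_divide_distrib)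
  moreover have "\<bar>\<integral>p. kernel p * (h (x + fst p *\<^sub>R snd p) - g (x + fst p *\<^sub>R snd p)) \<partial>lborel\<bar> \<le> (\<integral>p. d * kernel (p :: real \<times> 'a) \<partial>lborel)"
    (is "\<bar>integral\<^sup>L _ ?f\<bar> \<le> _")
  proof -
    have "norm (integral\<^sup>L lborel ?f) \<le> (\<integral>p. d * kernel (p :: real \<times> 'a) \<partial>lborel)"
    proof (rule Bochner_Integration.integral_norm_bound_integral)
      show "integrable lborel ?f"
        using Bochner_Integration.integrable_diff[OF ih ig] by (simp add: right_diff_distrib)
      show "norm (?f p) \<le> d * kernel p" for p
        using mult_left_mono[OF d[of "x + fst p *\<^sub>R snd p"] kernel_nonneg[of p]] by (simp add: abs_mult mult.commute)
    qed (intro integrable_mult_right integrable_kernel)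
    then show ?thesis by simp
  qed
  ultimately show ?thesis
    using mass_pos[where 'a='a] by (simp add: abs_divide pos_divide_le_eq integral_kernel)
qed

lemma res_const: "res (\<lambda>_. c) (x::'a::euclidean_space) = c"
  using mass_pos[where 'a='a] by (simp add: res_def integral_kernel)

lemma res_bound:
  assumes [measurable]: "h \<in> borel_measurable borel" and B: "\<And>x. \<bar>h x\<bar> \<le> B"
  shows "\<bar>res h x\<bar> \<le> B"
  using res_diff_bound[of h "\<lambda>_. 0" B 0 B x] B by (simp add: res_const)

lemma grad_res_bound:
  fixes h :: "'a::euclidean_space \<Rightarrow> real"
  assumes [measurable]: "h \<in> borel_measurable borel" and B: "\<And>x. \<bar>h x\<bar> \<le> B"
  shows "norm (grad_res h x) \<le> lip_const TYPE('a) * B"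
proof -
  have "norm (\<integral>p. (kernel' p * h (x + fst p *\<^sub>R snd p)) *\<^sub>R snd p \<partial>lborel) \<le> (\<integral>p. B * (kernel' p * norm (snd (p :: real \<times> 'a))) \<partial>lborel)"
    by (intro Bochner_Integration.integral_norm_bound_integral grad_res_integrable[OF assms]
          integrable_mult_right integrable_kernel' grad_res_norm_bound[OF B])
  then show ?thesis
    using mass_pos[where 'a='a] by (simp add: grad_res_def lip_const_def divide_simps mult_ac)
qed

lemma continuous_grad_res:
  fixes h :: "'a::euclidean_space \<Rightarrow> real"
  assumes cont: "continuous_on UNIV h" and B: "\<And>x. \<bar>h x\<bar> \<le> B"
  shows "continuous_on UNIV (grad_res h)"
proof -
  have [measurable]: "h \<in> borel_measurable borel" using cont by (rule borel_measurable_continuous_onI)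
  have "(\<lambda>n. grad_res h (X n)) \<longlonglongrightarrow> grad_res h x" if X: "X \<longlonglongrightarrow> x" for X x
    unfolding grad_res_def
  proof (intro tendsto_scaleR tendsto_const integral_dominated_convergence)
    show "integrable lborel (\<lambda>p :: real \<times> 'a. B * (kernel' p * norm (snd p)))"
      by (intro integrable_mult_right integrable_kernel')
    have "isCont h y" for y using cont by (simp add: continuous_on_eq_continuous_at)
    then show "AE p in lborel. (\<lambda>n. (kernel' p * h (X n + fst p *\<^sub>R snd p)) *\<^sub>R snd p)
        \<longlonglongrightarrow> (kernel' p * h (x + fst p *\<^sub>R snd p)) *\<^sub>R snd p"
      by (intro AE_I2 tendsto_scaleR tendsto_mult tendsto_const isCont_tendsto_compose[of _ h] tendsto_add X)
    show "AE p in lborel. norm ((kernel' p * h (X n + fst p *\<^sub>R snd p)) *\<^sub>R snd p) \<le> B * (kernel' p * norm (snd p))" for n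
      by (intro AE_I2 grad_res_norm_bound[OF B])
  qed simp_all
  then show ?thesis by (simp add: continuous_on_sequentially o_def)
qed

end

section \<open>Differentiating the resolvent by shifting the Gaussian\<close>

lemma gauss_shift_FTC:
  assumes "0 < s"
  shows "(\<integral>r. indicator {0..1} r * (gauss (z - (r / s) *\<^sub>R e) * ((z - (r / s) *\<^sub>R e) \<bullet> e) / s) \<partial>lborel)
       = gauss (z - (1 / s) *\<^sub>R e) - gauss z"
proof -
  have "(\<integral>r. (gauss (z - (r / s) *\<^sub>R e) * ((z - (r / s) *\<^sub>R e) \<bullet> e) / s) * indicator {0..1} r \<partial>lborel)
       = gauss (z - (1 / s) *\<^sub>R e) - gauss (z - (0 / s) *\<^sub>R e)"
  proof (rule integral_FTC_Icc_real)
    fix r :: real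
    show "((\<lambda>r. gauss (z - (r / s) *\<^sub>R e)) has_real_derivative
       gauss (z - (r / s) *\<^sub>R e) * ((z - (r / s) *\<^sub>R e) \<bullet> e) / s) (at r)"
      unfolding gauss_def inner_diff_left inner_diff_right inner_scaleR_left inner_scaleR_right using assms
      by (auto intro!: derivative_eq_intros simp: field_simps inner_commute)
    show "isCont (\<lambda>r. gauss (z - (r / s) *\<^sub>R e) * ((z - (r / s) *\<^sub>R e) \<bullet> e) / s) r"
      unfolding gauss_def using assms by (intro continuous_intros) auto
  qed simp
  then show ?thesis by (simp add: mult.commute)
qed

text \<open>Translating the argument of \<open>h\<close> by \<open>e\<close> amounts to translating
  the Gaussian by \<open>e / s\<close>. The Gaussian is smooth, so the increment is an integral over
  the shift parameter \<open>r\<close> even for discontinuous \<open>h\<close>. The factor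
  \<open>s\<close> on the left clears the 1/s produced by the derivative; the weight
  \<open>s * k s\<close> will supply it.\<close>

lemma gauss_shift:
  fixes h :: "'a::euclidean_space \<Rightarrow> real"
  assumes [measurable]: "h \<in> borel_measurable borel" and B: "\<And>x. \<bar>h x\<bar> \<le> B" and s: "0 < s"
  shows "s * ((\<integral>z. gauss z * h (x + e + s *\<^sub>R z) \<partial>lborel) - (\<integral>z. gauss z * h (x + s *\<^sub>R z) \<partial>lborel))
       = (\<integral>r. indicator {0..1} r * (\<integral>z. gauss z * (z \<bullet> e) * h (x + r *\<^sub>R e + s *\<^sub>R z) \<partial>lborel) \<partial>lborel)"
proof -
  define \<Phi> where "\<Phi> p = indicator {0..1} (fst p) *
      (gauss (snd p - (fst p / s) *\<^sub>R e) * ((snd p - (fst p / s) *\<^sub>R e) \<bullet> e) * h (x + s *\<^sub>R snd p))" for p :: "real \<times> 'a"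
  have [measurable]: "\<Phi> \<in> borel_measurable borel" unfolding \<Phi>_def by measurable
  define G where "G z = norm (z::'a) * gauss z" for z
  have [measurable]: "G \<in> borel_measurable borel" unfolding G_def by measurable
  have iG: "integrable lborel G" unfolding G_def by (rule integrable_norm_gauss)
  have iGs: "integrable lborel (\<lambda>z. G (z - c))" for c
    using iG integrable_lborel_translation[of G "-c"] by (simp add: add.commute)
  have jGs: "(\<integral>z. G (z - c) \<partial>lborel) = integral\<^sup>L lborel G" for c
    using integral_lborel_translation[of G "-c"] by simp
  \<comment> \<open>Cauchy-Schwarz majorant of \<Phi>. By translation invariance its integral in
    \<open>z\<close> is independent of \<open>r\<close> on the unit interval, so Tonelli
    applies.\<close>
  define \<Psi> where "\<Psi> p = indicator {0..1} (fst p) * (G (snd p - (fst p / s) *\<^sub>R e) * norm e * B)" for p :: "real \<times> 'a"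
  have [measurable]: "\<Psi> \<in> borel_measurable borel" unfolding \<Psi>_def by measurable
  have B0: "0 \<le> B" using B[of 0] by simp
  have \<Phi>\<Psi>: "norm (\<Phi> p) \<le> \<Psi> p" for p
  proof -
    let ?w = "snd p - (fst p / s) *\<^sub>R e"
    have "\<bar>?w \<bullet> e\<bar> * \<bar>h (x + s *\<^sub>R snd p)\<bar> \<le> (norm ?w * norm e) * B"
      by (intro mult_mono B Cauchy_Schwarz_ineq2) auto
    then have "gauss ?w * (\<bar>?w \<bullet> e\<bar> * \<bar>h (x + s *\<^sub>R snd p)\<bar>) \<le> gauss ?w * ((norm ?w * norm e) * B)"
      by (intro mult_left_mono) auto
    then show ?thesis by (auto simp: \<Phi>_def \<Psi>_def G_def indicator_def abs_mult mult_ac)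
  qed
  have "integrable (lborel \<Otimes>\<^sub>M lborel) \<Psi>"
  proof (rule lborel_pair.Fubini_integrable)
    show "\<Psi> \<in> borel_measurable (lborel \<Otimes>\<^sub>M lborel)" by (simp add: lborel_prod)
    have "(\<integral>z. norm (\<Psi> (r, z)) \<partial>lborel) = indicator {0..1} r * (integral\<^sup>L lborel G * norm e * B)" for r
    proof -
      have "norm (\<Psi> (r, z)) = indicator {0..1} r * norm e * B * G (z - (r / s) *\<^sub>R e)" for z
        using B0 by (simp add: \<Psi>_def G_def abs_mult)
      then show ?thesis by (simp add: jGs)
    qed
    then show "integrable lborel (\<lambda>r. \<integral>z. norm (\<Psi> (r, z)) \<partial>lborel)"
      by (auto intro!: integrable_mult_left integrable_real_indicator)
    show "AE r in lborel. integrable lborel (\<lambda>z. \<Psi> (r, z))"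
      by (intro AE_I2) (auto simp: \<Psi>_def intro!: integrable_mult_left integrable_mult_right iGs)
  qed
  then have "integrable lborel \<Psi>" by (simp add: lborel_prod)
  then have i\<Phi>: "integrable lborel \<Phi>"
    by (rule Bochner_Integration.integrable_bound) (use \<Phi>\<Psi> in \<open>auto intro!: order_trans[OF _ abs_ge_self]\<close>)
  have bnd: "integrable lborel (\<lambda>z. g z * h (x + s *\<^sub>R z))" if "integrable lborel g" for g :: "'a \<Rightarrow> real"
  proof (rule Bochner_Integration.integrable_bound)
    show "integrable lborel (\<lambda>z. g z * B)" using that by simp
    show "(\<lambda>z. g z * h (x + s *\<^sub>R z)) \<in> borel_measurable lborel"
      using borel_measurable_integrable[OF that] by simp
    show "AE z in lborel. norm (g z * h (x + s *\<^sub>R z)) \<le> norm (g z * B)"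
      unfolding real_norm_def abs_mult
      by (intro AE_I2 mult_left_mono order_trans[OF B abs_ge_self] abs_ge_zero)
  qed
  have g0: "integrable lborel (\<lambda>z::'a. gauss z)" by (rule integrable_gauss)
  have g1: "integrable lborel (\<lambda>z. gauss (z - (1 / s) *\<^sub>R e))"
    using g0 integrable_lborel_translation[of gauss "- (1 / s) *\<^sub>R e"] by (simp add: add.commute)
  have "(\<integral>r. indicator {0..1} r * (\<integral>z. gauss z * (z \<bullet> e) * h (x + r *\<^sub>R e + s *\<^sub>R z) \<partial>lborel) \<partial>lborel)
      = (\<integral>r. (\<integral>z. \<Phi> (r, z) \<partial>lborel) \<partial>lborel)"
  proof (rule Bochner_Integration.integral_cong[OF refl])
    fix r :: real
    \<comment> \<open>Translating \<open>z\<close> by \<open>(r / s) *\<^sub>R e\<close> recentres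
      the Gaussian and moves the shift \<open>r *\<^sub>R e\<close> into the argument of
      \<open>h\<close>.\<close>
    have "(\<integral>z. \<Phi> (r, z) \<partial>lborel) = (\<integral>z. \<Phi> (r, (r / s) *\<^sub>R e + z) \<partial>lborel)"
      by (rule integral_lborel_translation[symmetric]) measurable
    also have "\<dots> = (\<integral>z. indicator {0..1} r * (gauss z * (z \<bullet> e) * h (x + r *\<^sub>R e + s *\<^sub>R z)) \<partial>lborel)"
      using s by (intro Bochner_Integration.integral_cong[OF refl]) (simp add: \<Phi>_def scaleR_add_right add.assoc)
    finally show "indicator {0..1} r * (\<integral>z. gauss z * (z \<bullet> e) * h (x + r *\<^sub>R e + s *\<^sub>R z) \<partial>lborel)
       = (\<integral>z. \<Phi> (r, z) \<partial>lborel)" by simp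
  qed
  also have "\<dots> = (\<integral>z. (\<integral>r. \<Phi> (r, z) \<partial>lborel) \<partial>lborel)"
    using integral_lborel_fst[OF i\<Phi>] integral_lborel_snd[OF i\<Phi>] by simp
  also have "\<dots> = (\<integral>z. s * (gauss (z - (1 / s) *\<^sub>R e) * h (x + s *\<^sub>R z) - gauss z * h (x + s *\<^sub>R z)) \<partial>lborel)"
  proof (rule Bochner_Integration.integral_cong[OF refl])
    fix z :: 'a
    have "\<Phi> (r, z) = s * h (x + s *\<^sub>R z) * (indicator {0..1} r * (gauss (z - (r / s) *\<^sub>R e) * ((z - (r / s) *\<^sub>R e) \<bullet> e) / s))" for r
      using s by (simp add: \<Phi>_def)
    then have "(\<integral>r. \<Phi> (r, z) \<partial>lborel) = s * h (x + s *\<^sub>R z) * (gauss (z - (1 / s) *\<^sub>R e) - gauss z)"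
      by (simp only: integral_mult_right_zero gauss_shift_FTC[OF s])
    then show "(\<integral>r. \<Phi> (r, z) \<partial>lborel) = s * (gauss (z - (1 / s) *\<^sub>R e) * h (x + s *\<^sub>R z) - gauss z * h (x + s *\<^sub>R z))"
      by (simp add: algebra_simps)
  qed
  also have "\<dots> = s * ((\<integral>z. gauss (z - (1 / s) *\<^sub>R e) * h (x + s *\<^sub>R z) \<partial>lborel) - (\<integral>z. gauss z * h (x + s *\<^sub>R z) \<partial>lborel))"
    by (simp only: integral_mult_right_zero Bochner_Integration.integral_diff[OF bnd[OF g1] bnd[OF g0]])
  also have "(\<integral>z. gauss (z - (1 / s) *\<^sub>R e) * h (x + s *\<^sub>R z) \<partial>lborel)
      = (\<integral>z. gauss z * h (x + e + s *\<^sub>R z) \<partial>lborel)"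
    using s by (subst integral_lborel_translation[of _ "(1 / s) *\<^sub>R e", symmetric]) (simp_all add: scaleR_add_right add.assoc)
  finally show ?thesis by simp
qed

context yukawa
begin

lemma inner_grad_res:
  fixes h :: "'a::euclidean_space \<Rightarrow> real"
  assumes "h \<in> borel_measurable borel" and B: "\<And>x. \<bar>h x\<bar> \<le> B"
  shows "grad_res h x \<bullet> e = (\<integral>p. kernel' p * h (x + fst p *\<^sub>R snd p) * (snd p \<bullet> e) \<partial>lborel) / mass TYPE('a)"
  unfolding grad_res_def
  by (simp add: integral_inner_left[OF grad_res_integrable[OF assms], symmetric] divide_inverse mult.commute)

text \<open>Integrating \<open>gauss_shift\<close> against \<open>k s\<close> produces the weight of
  \<open>kernel\<close> on the left and that of \<open>kernel'\<close> on the right. The exchange of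
  \<open>s\<close> and \<open>r\<close> takes place after the Gaussian integrals \<open>P\<close>
  and \<open>Q\<close> are formed, so the uniform bound \<open>c\<close> on \<open>Q\<close>
  justifies it.\<close>

lemma res_line_integral:
  fixes h :: "'a::euclidean_space \<Rightarrow> real"
  assumes [measurable]: "h \<in> borel_measurable borel" and B: "\<And>x. \<bar>h x\<bar> \<le> B"
  shows "res h (x + e) - res h x = (\<integral>r. indicator {0..1} r * (grad_res h (x + r *\<^sub>R e) \<bullet> e) \<partial>lborel)"
proof -
  define Q where "Q s r = (\<integral>z. gauss z * (z \<bullet> e) * h (x + r *\<^sub>R e + s *\<^sub>R z) \<partial>(lborel::'a measure))" for s r :: real
  define P where "P y s = (\<integral>z. gauss z * h (y + s *\<^sub>R z) \<partial>(lborel::'a measure))" for y s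
  define c where "c = (\<integral>z. norm z * gauss z \<partial>(lborel::'a measure)) * norm e * B"
  have Q_dom: "norm (gauss z * (z \<bullet> e) * h (x + r *\<^sub>R e + s *\<^sub>R z)) \<le> norm z * gauss z * (norm e * B)" for s r and z :: 'a
  proof -
    have "\<bar>z \<bullet> e\<bar> * \<bar>h (x + r *\<^sub>R e + s *\<^sub>R z)\<bar> \<le> (norm z * norm e) * B"
      by (intro mult_mono B Cauchy_Schwarz_ineq2) auto
    then have "gauss z * (\<bar>z \<bullet> e\<bar> * \<bar>h (x + r *\<^sub>R e + s *\<^sub>R z)\<bar>) \<le> gauss z * ((norm z * norm e) * B)"
      by (intro mult_left_mono) auto
    then show ?thesis by (simp add: abs_mult mult_ac)
  qed
  have Qb: "\<bar>Q s r\<bar> \<le> c" for s r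
  proof -
    have iz: "integrable lborel (\<lambda>z::'a. norm z * gauss z * (norm e * B))"
      by (intro integrable_mult_left integrable_norm_gauss)
    have "integrable lborel (\<lambda>z. gauss z * (z \<bullet> e) * h (x + r *\<^sub>R e + s *\<^sub>R z))"
      by (rule Bochner_Integration.integrable_bound[OF iz _ AE_I2[OF order_trans[OF Q_dom]]]) auto
    then have "norm (Q s r) \<le> (\<integral>z. (norm z * gauss z) * (norm e * B) \<partial>(lborel::'a measure))"
      unfolding Q_def by (rule Bochner_Integration.integral_norm_bound_integral[OF _ iz Q_dom])
    then have "norm (Q s r) \<le> (\<integral>z. norm z * gauss z \<partial>(lborel::'a measure)) * (norm e * B)"
      by (simp only: integral_mult_left_zero)
    then show ?thesis by (simp add: c_def mult.assoc)
  qed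
  have Qm: "(\<lambda>p. Q (fst p) (snd p)) \<in> borel_measurable borel"
    unfolding Q_def borel_prod[symmetric] by measurable
  define \<Phi> where "\<Phi> p = k (fst p) * (indicator {0..1} (snd p) * Q (fst p) (snd p))" for p
  have i\<Phi>: "integrable lborel \<Phi>"
  proof (rule Bochner_Integration.integrable_bound)
    show "integrable lborel (\<lambda>p. c * (k (fst p) * indicator {0..1} (snd p :: real)))"
      by (intro integrable_mult_right integrable_lborel_times integrable_k integrable_real_indicator) auto
    show "\<Phi> \<in> borel_measurable lborel" unfolding \<Phi>_def using Qm by simp
    show "AE p in lborel. norm (\<Phi> p) \<le> norm (c * (k (fst p) * indicator {0..1} (snd p :: real)))"
    proof (intro AE_I2)
      fix p :: "real \<times> real"
      have "\<Phi> p = (k (fst p) * indicator {0..1} (snd p)) * Q (fst p) (snd p)" by (simp add: \<Phi>_def)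
      then show "norm (\<Phi> p) \<le> norm (c * (k (fst p) * indicator {0..1} (snd p :: real)))"
        by (simp only:) (intro norm_mult_le_bound Qb mult_nonneg_nonneg k_nonneg indicator_pos_le)
    qed
  qed
  have resP: "res h y * mass TYPE('a) = (\<integral>s. s * k s * P y s \<partial>lborel)" for y
  proof -
    have "res h y * mass TYPE('a) = (\<integral>p. kernel p * h (y + fst p *\<^sub>R snd p) \<partial>lborel)"
      using mass_pos[where 'a='a] by (simp add: res_def)
    also have "\<dots> = (\<integral>s. (\<integral>z. s * k s * (gauss z * h (y + s *\<^sub>R z)) \<partial>lborel) \<partial>lborel)"
      by (subst integral_lborel_fst[OF res_integrable[OF assms]]) (simp add: kernel_def mult_ac)
    finally show ?thesis by (simp add: P_def)
  qed
  have iP: "integrable lborel (\<lambda>s. s * k s * P y s)" for y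
  proof -
    have "integrable (lborel \<Otimes>\<^sub>M lborel) (\<lambda>p. kernel p * h (y + fst p *\<^sub>R snd p))"
      using res_integrable[OF assms, of y] by (simp add: lborel_prod)
    from lborel_pair.integrable_fst'[OF this] show ?thesis
      by (simp add: kernel_def P_def mult.assoc)
  qed
  have grad_resQ: "(grad_res h (x + r *\<^sub>R e) \<bullet> e) * mass TYPE('a) = (\<integral>s. k s * Q s r \<partial>lborel)" for r
  proof -
    have "(grad_res h (x + r *\<^sub>R e) \<bullet> e) * mass TYPE('a) =
        (\<integral>p. kernel' p * h (x + r *\<^sub>R e + fst p *\<^sub>R snd p) * (snd p \<bullet> e) \<partial>lborel)"
      using mass_pos[where 'a='a] by (simp add: inner_grad_res[OF assms])
    also have "\<dots> = (\<integral>s. (\<integral>z. k s * (gauss z * (z \<bullet> e) * h (x + r *\<^sub>R e + s *\<^sub>R z)) \<partial>lborel) \<partial>lborel)"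
    proof (subst integral_lborel_fst)
      have "integrable lborel (\<lambda>p. ((kernel' p * h (x + r *\<^sub>R e + fst p *\<^sub>R snd p)) *\<^sub>R snd p) \<bullet> e)"
        by (intro integrable_inner_left grad_res_integrable[OF assms])
      then show "integrable lborel (\<lambda>p. kernel' p * h (x + r *\<^sub>R e + fst p *\<^sub>R snd p) * (snd p \<bullet> e))"
        by simp
    qed (simp add: kernel'_def mult_ac)
    finally show ?thesis by (simp add: Q_def)
  qed
  have "(res h (x + e) - res h x) * mass TYPE('a) = (\<integral>s. s * k s * P (x + e) s - s * k s * P x s \<partial>lborel)"
    by (simp add: left_diff_distrib resP Bochner_Integration.integral_diff[OF iP iP])
  also have "\<dots> = (\<integral>s. (\<integral>r. \<Phi> (s, r) \<partial>lborel) \<partial>lborel)"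
  proof (rule Bochner_Integration.integral_cong[OF refl])
    fix s :: real
    show "s * k s * P (x + e) s - s * k s * P x s = (\<integral>r. \<Phi> (s, r) \<partial>lborel)"
    proof (cases "0 < s")
      case True
      have "s * k s * P (x + e) s - s * k s * P x s = k s * (s * (P (x + e) s - P x s))" by (simp add: algebra_simps)
      then show ?thesis
        unfolding P_def gauss_shift[OF assms True] by (simp add: \<Phi>_def Q_def)
    next
      case False
      then have "k s = 0" by (simp add: k_def)
      then show ?thesis by (simp add: \<Phi>_def)
    qed
  qed
  also have "\<dots> = (\<integral>r. (\<integral>s. \<Phi> (s, r) \<partial>lborel) \<partial>lborel)"
    using integral_lborel_fst[OF i\<Phi>] integral_lborel_snd[OF i\<Phi>] by simp
  also have "\<dots> = (\<integral>r. indicator {0..1} r * (grad_res h (x + r *\<^sub>R e) \<bullet> e) * mass TYPE('a) \<partial>lborel)"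
  proof (rule Bochner_Integration.integral_cong[OF refl])
    fix r :: real
    have "\<Phi> (s, r) = indicator {0..1} r * (k s * Q s r)" for s by (simp add: \<Phi>_def)
    then show "(\<integral>s. \<Phi> (s, r) \<partial>lborel) = indicator {0..1} r * (grad_res h (x + r *\<^sub>R e) \<bullet> e) * mass TYPE('a)"
      by (simp add: grad_resQ mult.assoc)
  qed
  also have "\<dots> = (\<integral>r. indicator {0..1} r * (grad_res h (x + r *\<^sub>R e) \<bullet> e) \<partial>lborel) * mass TYPE('a)"
    by simp
  finally show ?thesis using mass_pos[where 'a='a] by simp
qed

end

text \<open>The average of \<open>G\<close> over a short segment from \<open>x\<close> differs from
  \<open>G x\<close> by at most \<epsilon>, by continuity of \<open>G\<close> at \<open>x\<close>;
  this is the remainder estimate of differentiability.\<close>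

lemma has_derivative_line_integral:
  fixes f :: "'a::euclidean_space \<Rightarrow> real"
  assumes f: "\<And>x e. f (x + e) - f x = (\<integral>r. indicator {0..1} r * (G (x + r *\<^sub>R e) \<bullet> e) \<partial>lborel)"
    and G: "continuous_on UNIV G"
  shows "(f has_derivative (\<lambda>e. G x \<bullet> e)) (at x)"
  unfolding has_derivative_at_alt
proof (intro conjI allI impI)
  show "bounded_linear ((\<bullet>) (G x))" by (rule bounded_linear_inner_right)
  fix \<epsilon> :: real assume \<epsilon>: "0 < \<epsilon>"
  have "isCont G x" using G by (simp add: continuous_on_eq_continuous_at)
  then obtain d where d: "0 < d" "\<And>y. dist y x < d \<Longrightarrow> dist (G y) (G x) < \<epsilon>"
    using \<epsilon> unfolding continuous_at_eps_delta by blast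
  have "norm (f y - f x - G x \<bullet> (y - x)) \<le> \<epsilon> * norm (y - x)" if y: "norm (y - x) < d" for y
  proof -
    define e where "e = y - x"
    have Gm: "continuous_on UNIV (\<lambda>r. G (x + r *\<^sub>R e) \<bullet> e)"
      by (intro continuous_intros continuous_on_compose2[OF G]) auto
    have i1: "integrable lborel (\<lambda>r. indicator {0..1} r * (G (x + r *\<^sub>R e) \<bullet> e))"
      using borel_integrable_atLeastAtMost'[of 0 1 "\<lambda>r. G (x + r *\<^sub>R e) \<bullet> e"] continuous_on_subset[OF Gm]
      by (simp add: set_integrable_def)
    have i2: "integrable lborel (\<lambda>r::real. indicator {0..1} r * c)" for c :: real
      by (intro integrable_mult_left integrable_real_indicator) auto
    have "f y - f x - G x \<bullet> e = (\<integral>r. indicator {0..1} r * (G (x + r *\<^sub>R e) \<bullet> e) \<partial>lborel)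
          - (\<integral>r. indicator {0..1::real} r * (G x \<bullet> e) \<partial>lborel)"
      using f[of x e] by (simp add: e_def)
    also have "\<dots> = (\<integral>r. indicator {0..1} r * ((G (x + r *\<^sub>R e) - G x) \<bullet> e) \<partial>lborel)"
      by (subst Bochner_Integration.integral_diff[OF i1 i2, symmetric]) (simp add: inner_diff_left right_diff_distrib)
    finally have eq: "f y - f x - G x \<bullet> e = (\<integral>r. indicator {0..1} r * ((G (x + r *\<^sub>R e) - G x) \<bullet> e) \<partial>lborel)" .
    have "norm (f y - f x - G x \<bullet> e) \<le> (\<integral>r. indicator {0..1::real} r * (\<epsilon> * norm e) \<partial>lborel)"
      unfolding eq
    proof (rule Bochner_Integration.integral_norm_bound_integral[OF _ i2])
      show "integrable lborel (\<lambda>r. indicator {0..1} r * ((G (x + r *\<^sub>R e) - G x) \<bullet> e))"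
        using Bochner_Integration.integrable_diff[OF i1 i2[of "G x \<bullet> e"]] by (simp add: inner_diff_left right_diff_distrib)
      fix r :: real
      show "norm (indicator {0..1} r * ((G (x + r *\<^sub>R e) - G x) \<bullet> e)) \<le> indicator {0..1} r * (\<epsilon> * norm e)"
      proof (cases "r \<in> {0..1}")
        case True
        then have "norm (r *\<^sub>R e) \<le> norm e" by (simp add: mult_left_le_one_le)
        then have "dist (G (x + r *\<^sub>R e)) (G x) < \<epsilon>"
          using y by (intro d(2)) (simp add: dist_norm e_def)
        then have "norm (G (x + r *\<^sub>R e) - G x) * norm e \<le> \<epsilon> * norm e"
          by (intro mult_right_mono) (simp_all add: dist_norm)
        then show ?thesis using True Cauchy_Schwarz_ineq2[of "G (x + r *\<^sub>R e) - G x" e] by simp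
      qed simp
    qed
    then show ?thesis by (simp add: e_def)
  qed
  with d(1) show "\<exists>d>0. \<forall>y. norm (y - x) < d \<longrightarrow> norm (f y - f x - G x \<bullet> (y - x)) \<le> \<epsilon> * norm (y - x)"
    by blast
qed

context yukawa
begin

text \<open>This has to serve for discontinuous right-hand sides built from step functions, so the
  bound is read off the line integral instead of a derivative of \<open>res h\<close>.\<close>

lemma res_lipschitz:
  fixes h :: "'a::euclidean_space \<Rightarrow> real"
  assumes [measurable]: "h \<in> borel_measurable borel" and B: "\<And>x. \<bar>h x\<bar> \<le> B"
  shows "\<bar>res h y - res h x\<bar> \<le> lip_const TYPE('a) * B * norm (y - x)"
proof -
  have B0: "0 \<le> B" using B[of 0] by simp
  have "res h y - res h x = (\<integral>r. indicator {0..1} r * (grad_res h (x + r *\<^sub>R (y - x)) \<bullet> (y - x)) \<partial>lborel)"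
    using res_line_integral[OF assms, of x "y - x"] by simp
  also have "norm \<dots> \<le> (\<integral>r. indicator {0..1::real} r * (lip_const TYPE('a) * B * norm (y - x)) \<partial>lborel)"
    (is "norm (integral\<^sup>L _ ?f) \<le> (integral\<^sup>L _ ?g)")
  proof (cases "integrable lborel ?f")
    case True
    show ?thesis
    proof (rule Bochner_Integration.integral_norm_bound_integral[OF True])
      fix r :: real
      have "\<bar>grad_res h (x + r *\<^sub>R (y - x)) \<bullet> (y - x)\<bar> \<le> lip_const TYPE('a) * B * norm (y - x)"
        by (rule order_trans[OF Cauchy_Schwarz_ineq2 mult_right_mono[OF grad_res_bound[OF assms] norm_ge_zero]])
      then show "norm (?f r) \<le> ?g r" by (simp add: indicator_def)
    qed (intro integrable_mult_left integrable_real_indicator, auto)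
  next
    \<comment> \<open>A non-integrable function has Bochner integral 0 by convention, so the
      estimate holds without any regularity of \<open>grad_res h\<close> along the segment.\<close>
    case False
    then have "integral\<^sup>L lborel ?f = 0" by (rule not_integrable_integral_eq)
    then show ?thesis using B0 by simp
  qed
  finally show ?thesis by simp
qed

lemma res_has_derivative:
  fixes h :: "'a::euclidean_space \<Rightarrow> real"
  assumes "continuous_on UNIV h" and "\<And>x. \<bar>h x\<bar> \<le> B"
  shows "(res h has_derivative (\<lambda>e. grad_res h x \<bullet> e)) (at x)"
  using assms by (intro has_derivative_line_integral res_line_integral[of h B] continuous_grad_res[of h B]
      borel_measurable_continuous_onI)

text \<open>Both sides are the limit of the same difference quotients of \<open>res h\<close>: one
  with the derivative on the kernel, one with the limit taken under the integral. First derivatives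
  of \<open>res h\<close> thereby become resolvents, to which \<open>res_has_derivative\<close>
  applies once more.\<close>

lemma grad_res_eq_res_derivative:
  fixes h :: "'a::euclidean_space \<Rightarrow> real"
  assumes h: "\<And>x. (h has_derivative (\<lambda>e. H x \<bullet> e)) (at x)"
    and H: "continuous_on UNIV H" and B: "\<And>x. \<bar>h x\<bar> \<le> B" and B': "\<And>x. norm (H x) \<le> B'"
  shows "grad_res h x \<bullet> e = res (\<lambda>y. H y \<bullet> e) x"
proof -
  have ch: "continuous_on UNIV h"
    using h by (meson has_derivative_continuous continuous_at_imp_continuous_on)
  have [measurable]: "h \<in> borel_measurable borel" using ch by (rule borel_measurable_continuous_onI)
  have [measurable]: "H \<in> borel_measurable borel" using H by (rule borel_measurable_continuous_onI)
  define t where "t n = inverse (real (Suc n))" for n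
  have t: "t \<longlonglongrightarrow> 0" "\<And>n. t n > 0" unfolding t_def using LIMSEQ_inverse_real_of_nat by auto
  have t': "filterlim t (at 0) sequentially"
    using t by (auto simp: filterlim_at less_imp_neq[symmetric])
  have line: "((\<lambda>r. f (y + r *\<^sub>R e)) has_real_derivative (F (y + r *\<^sub>R e) \<bullet> e)) (at r)"
    if "\<And>x. (f has_derivative (\<lambda>e. F x \<bullet> e)) (at x)" for f F y r
  proof -
    have "((\<lambda>r. f (y + r *\<^sub>R e)) has_derivative (\<lambda>d. F (y + r *\<^sub>R e) \<bullet> (d *\<^sub>R e))) (at r)"
      by (rule has_derivative_compose[OF _ that]) (auto intro!: derivative_eq_intros)
    then show ?thesis by (simp add: has_field_derivative_def mult.commute[of _ "F _ \<bullet> e"])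
  qed
  have quot: "(\<lambda>n. (f (y + t n *\<^sub>R e) - f y) / t n) \<longlonglongrightarrow> F y \<bullet> e"
    if "\<And>x. (f has_derivative (\<lambda>e. F x \<bullet> e)) (at x)" for f F y
    using filterlim_compose[OF line[OF that, of y 0, unfolded has_field_derivative_iff] t'] by simp
  \<comment> \<open>The mean value theorem bounds the difference quotients of \<open>h\<close>
    uniformly, which yields the majorant for dominated convergence.\<close>
  have lip: "\<bar>(h (y + t n *\<^sub>R e) - h y) / t n\<bar> \<le> B' * norm e" for y n
  proof -
    obtain r where "h (y + t n *\<^sub>R e) - h (y + 0 *\<^sub>R e) = (t n - 0) * (H (y + r *\<^sub>R e) \<bullet> e)"
      using MVT2[of 0 "t n" "\<lambda>r. h (y + r *\<^sub>R e)" "\<lambda>r. H (y + r *\<^sub>R e) \<bullet> e"] t(2) line[OF h] by blast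
    then have "(h (y + t n *\<^sub>R e) - h y) / t n = H (y + r *\<^sub>R e) \<bullet> e" using t(2)[of n] by simp
    then show ?thesis
      using order_trans[OF Cauchy_Schwarz_ineq2 mult_right_mono[OF B' norm_ge_zero]] by simp
  qed
  have "(\<lambda>n. (res h (x + t n *\<^sub>R e) - res h x) / t n) \<longlonglongrightarrow> grad_res h x \<bullet> e"
    by (rule quot[OF res_has_derivative[OF ch B]])
  moreover have "(\<lambda>n. (res h (x + t n *\<^sub>R e) - res h x) / t n) \<longlonglongrightarrow> res (\<lambda>y. H y \<bullet> e) x"
  proof -
    let ?q = "\<lambda>n p. kernel p * ((h ((x + fst p *\<^sub>R snd p) + t n *\<^sub>R e) - h (x + fst p *\<^sub>R snd p)) / t n)"
    have "(res h (x + t n *\<^sub>R e) - res h x) / t n = (\<integral>p. ?q n p \<partial>lborel) / mass TYPE('a)" for n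
    proof -
      have "(\<integral>p. ?q n p \<partial>lborel) = (\<integral>p. (kernel p * h (x + t n *\<^sub>R e + fst p *\<^sub>R snd p) - kernel p * h (x + fst p *\<^sub>R snd p)) / t n \<partial>lborel)"
        by (simp add: right_diff_distrib add_ac)
      also have "\<dots> = ((\<integral>p. kernel p * h (x + t n *\<^sub>R e + fst p *\<^sub>R snd p) \<partial>lborel) - (\<integral>p. kernel p * h (x + fst p *\<^sub>R snd p) \<partial>lborel)) / t n"
        by (simp only: integral_divide_zero Bochner_Integration.integral_diff[OF res_integrable[of h B] res_integrable[of h B]] B \<open>h \<in> borel_measurable borel\<close>)
      finally show ?thesis by (simp add: res_def diff_divide_distrib mult.commute)
    qed
    moreover have "(\<lambda>n. (\<integral>p. ?q n p \<partial>lborel) / mass TYPE('a)) \<longlonglongrightarrow> res (\<lambda>y. H y \<bullet> e) x"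
      unfolding res_def
    proof (intro tendsto_divide tendsto_const integral_dominated_convergence)
      show "integrable lborel (\<lambda>p :: real \<times> 'a. (B' * norm e) * kernel p)"
        by (intro integrable_mult_right integrable_kernel)
      show "AE p in lborel. (\<lambda>n. ?q n p) \<longlonglongrightarrow> kernel p * (H (x + fst p *\<^sub>R snd p) \<bullet> e)"
        by (intro AE_I2 tendsto_mult tendsto_const quot[OF h])
      show "AE p in lborel. norm (?q n p) \<le> (B' * norm e) * kernel p" for n
        using mult_left_mono[OF lip kernel_nonneg]
        by (intro AE_I2) (simp only: real_norm_def abs_mult abs_of_nonneg[OF kernel_nonneg] mult.commute)
    qed (use mass_pos[where 'a='a] in simp_all)
    ultimately show ?thesis by simp
  qed
  ultimately show ?thesis by (rule LIMSEQ_unique)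
qed

text \<open>Summed over the coordinates, \<open>(H (x + s z) \<bullet> z)\<close> is the derivative of \<open>h (x + s z)\<close> in the
  radial variable \<open>s\<close>; integrating it by parts against \<open>k\<close> yields the resolvent equation.\<close>

lemma grad_res_divergence:
  fixes h :: "'a::euclidean_space \<Rightarrow> real"
  assumes h: "\<And>x. (h has_derivative (\<lambda>e. H x \<bullet> e)) (at x)"
    and H: "continuous_on UNIV H" and B: "\<And>x. \<bar>h x\<bar> \<le> B" and B': "\<And>x. norm (H x) \<le> B'"
  shows "(\<Sum>b\<in>Basis. grad_res (\<lambda>y. H y \<bullet> b) x \<bullet> b) = l * (res h x - h x)"
proof -
  have ch: "continuous_on UNIV h"
    using h by (meson has_derivative_continuous continuous_at_imp_continuous_on)
  have hm [measurable]: "h \<in> borel_measurable borel" using ch by (rule borel_measurable_continuous_onI)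
  have [measurable]: "H \<in> borel_measurable borel" using H by (rule borel_measurable_continuous_onI)
  have Hb: "\<bar>H y \<bullet> b\<bar> \<le> B' * norm b" for y b
    by (rule order_trans[OF Cauchy_Schwarz_ineq2 mult_right_mono[OF B' norm_ge_zero]])
  define \<Phi> where "\<Phi> p = kernel' p * (H (x + fst p *\<^sub>R snd p) \<bullet> snd p)" for p :: "real \<times> 'a"
  have i: "integrable lborel (\<lambda>p. kernel' p * (H (x + fst p *\<^sub>R snd p) \<bullet> b) * (snd p \<bullet> b))" for b
    using integrable_inner_left[OF grad_res_integrable[of "\<lambda>y. H y \<bullet> b" "B' * norm b" x], of b] Hb by simp
  have \<Phi>: "\<Phi> p = (\<Sum>b\<in>Basis. kernel' p * (H (x + fst p *\<^sub>R snd p) \<bullet> b) * (snd p \<bullet> b))" for p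
    unfolding \<Phi>_def by (subst euclidean_inner) (simp add: sum_distrib_left mult.assoc)
  have i\<Phi>: "integrable lborel \<Phi>"
    unfolding \<Phi> by (intro Bochner_Integration.integrable_sum i)
  have "(\<Sum>b\<in>Basis. grad_res (\<lambda>y. H y \<bullet> b) x \<bullet> b) * mass TYPE('a) = (\<integral>p. \<Phi> p \<partial>lborel)"
  proof -
    have "(\<integral>p. \<Phi> p \<partial>lborel) = (\<Sum>b\<in>Basis. \<integral>p. kernel' p * (H (x + fst p *\<^sub>R snd p) \<bullet> b) * (snd p \<bullet> b) \<partial>lborel)"
      unfolding \<Phi> by (intro Bochner_Integration.integral_sum i)
    also have "\<dots> = (\<Sum>b\<in>Basis. grad_res (\<lambda>y. H y \<bullet> b) x \<bullet> b * mass TYPE('a))"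
    proof (intro sum.cong refl)
      fix b :: 'a
      show "(\<integral>p. kernel' p * (H (x + fst p *\<^sub>R snd p) \<bullet> b) * (snd p \<bullet> b) \<partial>lborel) = grad_res (\<lambda>y. H y \<bullet> b) x \<bullet> b * mass TYPE('a)"
        using mass_pos[where 'a='a] by (subst inner_grad_res[of _ "B' * norm b"]) (use Hb in auto)
    qed
    finally show ?thesis by (simp add: sum_distrib_right)
  qed
  also have "\<dots> = (\<integral>z. (\<integral>s. \<Phi> (s, z) \<partial>lborel) \<partial>lborel)" by (rule integral_lborel_snd[OF i\<Phi>])
  also have "\<dots> = (\<integral>z. l * (\<integral>s. kernel (s, z) * h (x + s *\<^sub>R z) \<partial>lborel) - gauss z * h x \<partial>lborel)"
  proof (rule Bochner_Integration.integral_cong[OF refl])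
    fix z :: 'a
    have "(\<integral>s. k s * (H (x + s *\<^sub>R z) \<bullet> z) \<partial>lborel) = l * (\<integral>s. s * k s * h (x + s *\<^sub>R z) \<partial>lborel) - h (x + 0 *\<^sub>R z)"
    proof (rule k_by_parts)
      fix s :: real
      have "((\<lambda>r. h (x + r *\<^sub>R z)) has_derivative (\<lambda>d. H (x + s *\<^sub>R z) \<bullet> (d *\<^sub>R z))) (at s)"
        by (rule has_derivative_compose[OF _ h]) (auto intro!: derivative_eq_intros)
      then show "((\<lambda>s. h (x + s *\<^sub>R z)) has_real_derivative H (x + s *\<^sub>R z) \<bullet> z) (at s)"
        by (simp add: has_field_derivative_def mult.commute[of _ "H _ \<bullet> z"])
    qed (auto intro!: B Hb continuous_intros continuous_on_compose2[OF H])
    then have "gauss z * (\<integral>s. k s * (H (x + s *\<^sub>R z) \<bullet> z) \<partial>lborel) = gauss z * (l * (\<integral>s. s * k s * h (x + s *\<^sub>R z) \<partial>lborel) - h x)"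
      by simp
    moreover have "(\<integral>s. \<Phi> (s, z) \<partial>lborel) = gauss z * (\<integral>s. k s * (H (x + s *\<^sub>R z) \<bullet> z) \<partial>lborel)"
      by (subst integral_mult_right_zero[symmetric]) (simp add: \<Phi>_def kernel'_def mult_ac)
    moreover have "(\<integral>s. kernel (s, z) * h (x + s *\<^sub>R z) \<partial>lborel) = gauss z * (\<integral>s. s * k s * h (x + s *\<^sub>R z) \<partial>lborel)"
      by (subst integral_mult_right_zero[symmetric]) (simp add: kernel_def mult_ac)
    ultimately show "(\<integral>s. \<Phi> (s, z) \<partial>lborel) = l * (\<integral>s. kernel (s, z) * h (x + s *\<^sub>R z) \<partial>lborel) - gauss z * h x"
      by (simp add: algebra_simps)
  qed
  also have "\<dots> = l * (\<integral>z. (\<integral>s. kernel (s, z) * h (x + s *\<^sub>R z) \<partial>lborel) \<partial>lborel) - (\<integral>z. gauss (z::'a) \<partial>lborel) * h x"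
  proof -
    note ir = res_integrable[OF hm B, of x]
    have "integrable lborel (\<lambda>z. \<integral>s. kernel (s, z) * h (x + s *\<^sub>R z) \<partial>lborel)"
      using lborel_pair.integrable_snd[of "\<lambda>s z. kernel (s, z) * h (x + s *\<^sub>R z)"] ir
      by (simp add: lborel_prod case_prod_unfold)
    then show ?thesis
      by (subst Bochner_Integration.integral_diff) (auto intro!: integrable_mult_right integrable_mult_left integrable_gauss)
  qed
  also have "\<dots> = l * (res h x * mass TYPE('a)) - l * mass TYPE('a) * h x"
    using integral_lborel_snd[OF res_integrable[OF hm B, of x]] mass_pos[where 'a='a]
    by (simp add: res_def mass_eq)
  also have "\<dots> = (l * (res h x - h x)) * mass TYPE('a)" by (simp add: algebra_simps)
  finally show ?thesis using mass_pos[where 'a='a] by simp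
qed

end

section \<open>Fixed points\<close>

text \<open>Kuhn's combinatorial lemma on a grid of mesh \<open>1 / p\<close>: the small cube at
  \<open>q\<close> has, for each coordinate, a vertex where \<open>G\<close> does not decrease it
  and a vertex where \<open>G\<close> does not increase it; uniform continuity transfers both to
  \<open>q\<close>. The dimension \<open>n\<close> is a variable, as it grows with the number of
  sample points. An approximate fixed point is enough because a limit is taken afterwards.\<close>

lemma approximate_fixed_point_nat:
  fixes G :: "(nat \<Rightarrow> real) \<Rightarrow> nat \<Rightarrow> real"
  assumes self: "\<And>v i. (\<And>j. j < n \<Longrightarrow> v j \<in> {0..1}) \<Longrightarrow> i < n \<Longrightarrow> G v i \<in> {0..1}"
    and ucont: "\<And>\<epsilon>. 0 < \<epsilon> \<Longrightarrow> \<exists>\<delta>>0. \<forall>v w. (\<forall>j<n. v j \<in> {0..1} \<and> w j \<in> {0..1} \<and> \<bar>v j - w j\<bar> \<le> \<delta>)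
           \<longrightarrow> (\<forall>i<n. \<bar>G v i - G w i\<bar> \<le> \<epsilon>)"
    and \<epsilon>: "0 < \<epsilon>"
  obtains v where "\<And>j. j < n \<Longrightarrow> v j \<in> {0..1}" and "\<And>i. i < n \<Longrightarrow> \<bar>G v i - v i\<bar> \<le> \<epsilon>"
proof -
  obtain \<delta> where \<delta>: "0 < \<delta>" and G: "\<And>v w i. (\<And>j. j < n \<Longrightarrow> v j \<in> {0..1} \<and> w j \<in> {0..1} \<and> \<bar>v j - w j\<bar> \<le> \<delta>)
      \<Longrightarrow> i < n \<Longrightarrow> \<bar>G v i - G w i\<bar> \<le> \<epsilon> / 2"
    using ucont[of "\<epsilon> / 2"] \<epsilon> by (meson half_gt_zero)
  \<comment> \<open>One half of \<epsilon> pays for the change of \<open>G\<close> between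
    \<open>q\<close> and a vertex, the other for the change of the coordinate itself.\<close>
  obtain m where m: "inverse (real (Suc m)) < min \<delta> (\<epsilon> / 2)"
    using reals_Archimedean[of "min \<delta> (\<epsilon> / 2)"] \<delta> \<epsilon> by auto
  define p where "p = Suc m"
  have p: "0 < p" "1 / real p \<le> \<delta>" "1 / real p \<le> \<epsilon> / 2" using m by (auto simp: p_def inverse_eq_divide)
  define sc where "sc x = (\<lambda>i. real (x i) / real p)" for x :: "nat \<Rightarrow> nat"
  \<comment> \<open>The guard \<open>x i < p\<close> forces label 1 on the upper face, as Kuhn's
    lemma demands; on the lower face label 0 results from nonnegativity of \<open>G\<close>.\<close>
  define label where "label x i = (if x i < p \<and> sc x i \<le> G (sc x) i then 0 else 1 :: nat)" for x i
  have sc01: "sc x i \<in> {0..1}" if "x i \<le> p" for x i using that p(1) by (simp add: sc_def)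
  have Gsc: "G (sc x) i \<in> {0..1}" if "\<forall>j<n. x j \<le> p" "i < n" for x i
    using that by (intro self sc01) auto
  obtain q where q: "\<forall>i<n. q i < p"
    and rs: "\<forall>i<n. \<exists>r s. (\<forall>j<n. q j \<le> r j \<and> r j \<le> q j + 1) \<and> (\<forall>j<n. q j \<le> s j \<and> s j \<le> q j + 1) \<and> label r i \<noteq> label s i"
  proof (rule kuhn_lemma[of p n label])
    show "\<forall>x. (\<forall>i<n. x i \<le> p) \<longrightarrow> (\<forall>i<n. x i = 0 \<longrightarrow> label x i = 0)"
      using Gsc p(1) by (auto simp: label_def sc_def)
  qed (use p(1) in \<open>auto simp: label_def\<close>)
  show thesis
  proof (rule that)
    show "sc q j \<in> {0..1}" if "j < n" for j using q that by (intro sc01) auto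
    fix i assume i: "i < n"
    obtain r s where r: "\<forall>j<n. q j \<le> r j \<and> r j \<le> q j + 1" "label r i = 0"
      and s: "\<forall>j<n. q j \<le> s j \<and> s j \<le> q j + 1" "label s i = 1"
    proof -
      obtain r s where *: "\<forall>j<n. q j \<le> r j \<and> r j \<le> q j + 1" "\<forall>j<n. q j \<le> s j \<and> s j \<le> q j + 1" "label r i \<noteq> label s i"
        using rs i by blast
      have "label r i = 0 \<and> label s i = 1 \<or> label s i = 0 \<and> label r i = 1"
        using *(3) by (auto simp: label_def split: if_splits)
      with * that show thesis by blast
    qed
    have near: "\<bar>G (sc q) i - G (sc x) i\<bar> \<le> \<epsilon> / 2" and close: "sc q i \<le> sc x i" "sc x i \<le> sc q i + \<epsilon> / 2"
      and xp: "\<forall>j<n. x j \<le> p"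
      if x: "\<forall>j<n. q j \<le> x j \<and> x j \<le> q j + 1" for x
    proof -
      have d: "sc q j \<le> sc x j \<and> sc x j \<le> sc q j + 1 / p" if "j < n" for j
      proof -
        have "real (q j) \<le> real (x j)" "real (x j) \<le> real (q j) + 1"
          using x that by (auto simp: of_nat_mono dest!: spec[of _ j])
        then show ?thesis using p(1) by (auto simp: sc_def divide_simps)
      qed
      show xp: "\<forall>j<n. x j \<le> p"
      proof (intro allI impI)
        fix j assume "j < n"
        then have "q j < p" "x j \<le> q j + 1" using x q by auto
        then show "x j \<le> p" by linarith
      qed
      show "\<bar>G (sc q) i - G (sc x) i\<bar> \<le> \<epsilon> / 2"
      proof (rule G[OF _ i], intro conjI)
        fix j assume j: "j < n"
        show "sc q j \<in> {0..1}" using j q by (intro sc01) auto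
        show "sc x j \<in> {0..1}" using j xp by (intro sc01) auto
        show "\<bar>sc q j - sc x j\<bar> \<le> \<delta>" using d[OF j] p(2) by linarith
      qed
      show "sc q i \<le> sc x i" "sc x i \<le> sc q i + \<epsilon> / 2" using d[OF i] p(3) by auto
    qed
    have "sc r i \<le> G (sc r) i" using r(2) by (simp add: label_def split: if_splits)
    then have lo: "sc q i - \<epsilon> / 2 \<le> G (sc q) i" using near[OF r(1)] close[OF r(1)] by linarith
    have "G (sc s) i \<le> sc s i"
    proof (cases "s i < p")
      case True
      then show ?thesis using s(2) by (simp add: label_def split: if_splits)
    next
      case False
      then have "s i = p" using xp[OF s(1)] i by (meson le_neq_implies_less)
      then show ?thesis using Gsc[OF xp[OF s(1)] i] p(1) by (simp add: sc_def)
    qed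
    then have "G (sc q) i \<le> sc q i + \<epsilon>" using near[OF s(1)] close[OF s(1)] by linarith
    with lo \<epsilon> show "\<bar>G (sc q) i - sc q i\<bar> \<le> \<epsilon>" by linarith
  qed
qed

text \<open>An enumeration of \<open>I\<close> and the affine bijection of [0, 1] onto [-R, R]
  conjugate \<open>G\<close> to a map of the unit cube. Lengths scale by \<open>2 * R\<close>, hence
  the tolerances divided by it.\<close>

lemma approximate_fixed_point:
  fixes G :: "('k \<Rightarrow> real) \<Rightarrow> 'k \<Rightarrow> real"
  assumes I: "finite I" and R: "0 < R"
    and self: "\<And>v i. (\<And>j. j \<in> I \<Longrightarrow> \<bar>v j\<bar> \<le> R) \<Longrightarrow> i \<in> I \<Longrightarrow> \<bar>G v i\<bar> \<le> R"
    and ucont: "\<And>\<epsilon>. 0 < \<epsilon> \<Longrightarrow> \<exists>\<delta>>0. \<forall>v w. (\<forall>j\<in>I. \<bar>v j\<bar> \<le> R \<and> \<bar>w j\<bar> \<le> R \<and> \<bar>v j - w j\<bar> \<le> \<delta>)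
           \<longrightarrow> (\<forall>i\<in>I. \<bar>G v i - G w i\<bar> \<le> \<epsilon>)"
    and \<epsilon>: "0 < \<epsilon>"
  obtains v where "\<And>j. j \<in> I \<Longrightarrow> \<bar>v j\<bar> \<le> R" and "\<And>i. i \<in> I \<Longrightarrow> \<bar>G v i - v i\<bar> \<le> \<epsilon>"
proof -
  obtain b where b: "bij_betw b {..<card I} I"
    using ex_bij_betw_nat_finite[OF I] by (auto simp: atLeast0LessThan)
  define b' where "b' = inv_into {..<card I} b"
  have b': "b' i < card I" "b (b' i) = i" if "i \<in> I" for i
    using that b by (auto simp: b'_def bij_betw_def inv_into_into f_inv_into_f)
      (metis inv_into_into lessThan_iff)
  have bI: "b i \<in> I" "b' (b i) = i" if "i < card I" for i
    using that b by (auto simp: b'_def bij_betw_def)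
  define dil where "dil v j = R * (2 * v (b' j) - 1)" for v :: "nat \<Rightarrow> real" and j
  define G' where "G' v i = (G (dil v) (b i) / R + 1) / 2" for v i
  have dil: "\<bar>dil v j\<bar> \<le> R" if "\<And>i. i < card I \<Longrightarrow> v i \<in> {0..1}" "j \<in> I" for v j
  proof -
    have "\<bar>2 * v (b' j) - 1\<bar> \<le> 1" using that(1)[OF b'(1)[OF that(2)]] by auto
    then show ?thesis using R by (simp add: dil_def abs_mult mult_left_le)
  qed
  obtain v where v: "\<And>j. j < card I \<Longrightarrow> v j \<in> {0..1}" "\<And>i. i < card I \<Longrightarrow> \<bar>G' v i - v i\<bar> \<le> \<epsilon> / (2 * R)"
  proof (rule approximate_fixed_point_nat[of "card I" G' "\<epsilon> / (2 * R)"])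
    fix v i assume "\<And>j. j < card I \<Longrightarrow> v j \<in> {0..1::real}" "i < card I"
    then have "\<bar>G (dil v) (b i)\<bar> \<le> R" using bI dil by (intro self) auto
    then have "\<bar>G (dil v) (b i) / R\<bar> \<le> 1" using R by (simp add: abs_divide)
    moreover have "(t + 1) / 2 \<in> {0..1}" if "\<bar>t\<bar> \<le> 1" for t :: real using that by auto
    ultimately show "G' v i \<in> {0..1}" unfolding G'_def by blast
  next
    fix \<eta> :: real assume "0 < \<eta>"
    then obtain \<delta> where \<delta>: "0 < \<delta>" and d: "\<And>v w i. (\<And>j. j \<in> I \<Longrightarrow> \<bar>v j\<bar> \<le> R \<and> \<bar>w j\<bar> \<le> R \<and> \<bar>v j - w j\<bar> \<le> \<delta>)
           \<Longrightarrow> i \<in> I \<Longrightarrow> \<bar>G v i - G w i\<bar> \<le> 2 * R * \<eta>"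
      using ucont[of "2 * R * \<eta>"] R by (metis mult_pos_pos zero_less_numeral)
    show "\<exists>\<delta>>0. \<forall>v w. (\<forall>j<card I. v j \<in> {0..1} \<and> w j \<in> {0..1} \<and> \<bar>v j - w j\<bar> \<le> \<delta>)
           \<longrightarrow> (\<forall>i<card I. \<bar>G' v i - G' w i\<bar> \<le> \<eta>)"
    proof (intro exI conjI allI impI)
      show "0 < \<delta> / (2 * R)" using \<delta> R by simp
      fix v w i assume vw: "\<forall>j<card I. v j \<in> {0..1} \<and> w j \<in> {0..1} \<and> \<bar>v j - w j\<bar> \<le> \<delta> / (2 * R)" and i: "i < card I"
      have "\<bar>G (dil v) (b i) - G (dil w) (b i)\<bar> \<le> 2 * R * \<eta>"
      proof (rule d[OF _ bI(1)[OF i]], intro conjI)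
        fix j assume j: "j \<in> I"
        show "\<bar>dil v j\<bar> \<le> R" "\<bar>dil w j\<bar> \<le> R" using vw j by (auto intro!: dil)
        have "dil v j - dil w j = (2 * R) * (v (b' j) - w (b' j))" by (simp add: dil_def algebra_simps)
        then have "\<bar>dil v j - dil w j\<bar> = (2 * R) * \<bar>v (b' j) - w (b' j)\<bar>" using R by (simp add: abs_mult)
        also have "\<dots> \<le> (2 * R) * (\<delta> / (2 * R))" using vw b'(1)[OF j] R by (intro mult_left_mono) auto
        finally show "\<bar>dil v j - dil w j\<bar> \<le> \<delta>" using R by simp
      qed
      moreover have "G (dil v) (b i) - G (dil w) (b i) = (2 * R) * (G' v i - G' w i)"
        using R by (simp add: G'_def field_simps)
      ultimately have "(2 * R) * \<bar>G' v i - G' w i\<bar> \<le> (2 * R) * \<eta>" using R by (simp only: abs_mult)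
      then show "\<bar>G' v i - G' w i\<bar> \<le> \<eta>" using R by simp
    qed
  qed (use \<epsilon> R in auto)
  show thesis
  proof (rule that[of "dil v"])
    show "\<bar>dil v j\<bar> \<le> R" if "j \<in> I" for j using v(1) that by (rule dil)
    fix i assume i: "i \<in> I"
    have "G (dil v) i - dil v i = (2 * R) * (G' v (b' i) - v (b' i))"
      using R b'(2)[OF i] by (simp add: G'_def dil_def field_simps)
    then have "\<bar>G (dil v) i - dil v i\<bar> = (2 * R) * \<bar>G' v (b' i) - v (b' i)\<bar>" using R by (simp add: abs_mult)
    also have "\<dots> \<le> (2 * R) * (\<epsilon> / (2 * R))" using v(2)[OF b'(1)[OF i]] R by (intro mult_left_mono) auto
    finally show "\<bar>G (dil v) i - dil v i\<bar> \<le> \<epsilon>" using R by simp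
  qed
qed

text \<open>Index of a closest point among \<open>q 0\<close>, ..., \<open>q n\<close>, the smaller
  index winning ties. The recursive form lets measurability follow by induction.\<close>

primrec nearest :: "(nat \<Rightarrow> 'a::metric_space) \<Rightarrow> nat \<Rightarrow> 'a \<Rightarrow> nat" where
  "nearest q 0 x = 0"
| "nearest q (Suc n) x = (if dist x (q (Suc n)) < dist x (q (nearest q n x)) then Suc n else nearest q n x)"

lemma nearest_le: "nearest q n x \<le> n"
  by (induction n) (auto intro: le_SucI)

lemma dist_nearest: "k \<le> n \<Longrightarrow> dist x (q (nearest q n x)) \<le> dist x (q k)"
proof (induction n)
  case (Suc n)
  then show ?case by (cases "k = Suc n") (auto simp: le_Suc_eq)
qed simp

lemma nearest_measurable:
  fixes q :: "nat \<Rightarrow> 'a::{metric_space, second_countable_topology}"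
  shows "nearest q n \<in> measurable borel (count_space UNIV)"
proof (induction n)
  case (Suc n)
  note [measurable] = Suc
  have [measurable]: "(\<lambda>x. dist x (q (nearest q n x))) \<in> borel_measurable borel"
    by (rule measurable_compose_countable[OF _ Suc]) measurable
  show ?case unfolding nearest.simps by measurable
qed simp

context yukawa
begin

lemma res_tendsto:
  fixes g :: "'a::euclidean_space \<Rightarrow> real"
  assumes [measurable]: "\<And>n. G n \<in> borel_measurable borel" "g \<in> borel_measurable borel"
    and B: "\<And>n y. \<bar>G n y\<bar> \<le> B" and lim: "\<And>y. (\<lambda>n. G n y) \<longlonglongrightarrow> g y"
  shows "(\<lambda>n. res (G n) x) \<longlonglongrightarrow> res g x"
  unfolding res_def
proof (intro tendsto_divide tendsto_const integral_dominated_convergence)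
  show "integrable lborel (\<lambda>p :: real \<times> 'a. B * kernel p)"
    by (intro integrable_mult_right integrable_kernel)
  show "AE p in lborel. (\<lambda>n. kernel p * G n (x + fst p *\<^sub>R snd p)) \<longlonglongrightarrow> kernel p * g (x + fst p *\<^sub>R snd p)"
    by (intro AE_I2 tendsto_mult tendsto_const lim)
  show "AE p in lborel. norm (kernel p * G n (x + fst p *\<^sub>R snd p)) \<le> B * kernel p" for n
    using mult_left_mono[OF B kernel_nonneg]
    by (intro AE_I2) (simp only: real_norm_def abs_mult abs_of_nonneg[OF kernel_nonneg] mult.commute)
qed (use mass_pos[where 'a='a] in simp_all)

text \<open>The resolvent sees \<open>h\<close> on the whole space, so continuity of the
  finite-dimensional maps rests on \<open>h_ucont\<close> being uniform in \<open>x\<close>.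
  Invariance of the cube comes from \<open>h_bound\<close>, and equicontinuity from
  \<open>res_lipschitz\<close>, however irregular the step functions are.\<close>

lemma res_fixed_point:
  fixes h :: "'m::finite \<Rightarrow> 'a::euclidean_space \<Rightarrow> real ^ 'm \<Rightarrow> real"
  assumes R: "0 < R"
    and h_cont: "\<And>i. continuous_on UNIV (\<lambda>p. h i (fst p) (snd p))"
    and h_bound: "\<And>i x z. (\<And>j. \<bar>z $ j\<bar> \<le> R) \<Longrightarrow> \<bar>h i x z\<bar> \<le> R"
    and h_ucont: "\<And>\<epsilon>. 0 < \<epsilon> \<Longrightarrow> \<exists>\<delta>>0. \<forall>i x z w. (\<forall>j. \<bar>z $ j\<bar> \<le> R \<and> \<bar>w $ j\<bar> \<le> R \<and> \<bar>z $ j - w $ j\<bar> \<le> \<delta>)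
           \<longrightarrow> \<bar>h i x z - h i x w\<bar> \<le> \<epsilon>"
  obtains u where "continuous_on UNIV u" and "\<And>x i. \<bar>u x $ i\<bar> \<le> R" and "\<And>x i. u x $ i = res (\<lambda>y. h i y (u y)) x"
proof -
  obtain D :: "'a set" where D: "countable D" "\<And>X. open X \<Longrightarrow> X \<noteq> {} \<Longrightarrow> \<exists>d\<in>D. d \<in> X"
    using countable_dense_exists by blast
  define q where "q = from_nat_into D"
  have "D \<noteq> {}" using D(2)[of UNIV] by auto
  then have q: "\<exists>j. dist x (q j) < \<epsilon>" if "0 < \<epsilon>" for x \<epsilon>
  proof -
    obtain d where "d \<in> D" "d \<in> ball x \<epsilon>" using D(2)[of "ball x \<epsilon>"] \<open>0 < \<epsilon>\<close> by auto
    then show ?thesis using from_nat_into_surj[OF D(1)] by (metis mem_ball q_def)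
  qed
  have hm: "(\<lambda>y. h i y (u y)) \<in> borel_measurable borel" if "u \<in> borel_measurable borel" for i u
    using borel_measurable_continuous_Pair[OF measurable_ident_sets[OF refl] that h_cont[of i]] by simp
  \<comment> \<open>Step function, constant on each cell of points that share the same nearest
    sample point.\<close>
  define U where "U n v y = (\<chi> i. v (nearest q n y, i))" for n and v :: "nat \<times> 'm \<Rightarrow> real" and y
  have Um: "U n v \<in> borel_measurable borel" for n v
  proof -
    have "(\<lambda>j. \<chi> i. v (j, i)) \<in> measurable (count_space UNIV) borel" by simp
    from measurable_compose[OF nearest_measurable this] show ?thesis by (simp add: U_def[abs_def])
  qed
  define A where "A n = {..n} \<times> (UNIV :: 'm set)" for n :: nat
  have A: "(nearest q n y, i) \<in> A n" for n y i by (simp add: A_def nearest_le)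
  define w where "w n v i x = res (\<lambda>y. h i y (U n v y)) x" for n v i x
  have hU: "\<bar>h i y (U n v y)\<bar> \<le> R" if "\<And>j. j \<in> A n \<Longrightarrow> \<bar>v j\<bar> \<le> R" for n v i y
    using that A by (intro h_bound) (simp add: U_def)
  \<comment> \<open>The unknowns are the values at the sample points: the map applies the resolvent
    to the nonlinearity of the step function and samples the result again.\<close>
  have "\<exists>v. (\<forall>j\<in>A n. \<bar>v j\<bar> \<le> R) \<and> (\<forall>j\<in>A n. \<bar>w n v (snd j) (q (fst j)) - v j\<bar> \<le> inverse (real (Suc n)))" for n
  proof (rule approximate_fixed_point[where I = "A n" and R = R and G = "\<lambda>v j. w n v (snd j) (q (fst j))"
        and \<epsilon> = "inverse (real (Suc n))"])
    fix v j assume "\<And>j. j \<in> A n \<Longrightarrow> \<bar>v j\<bar> \<le> R"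
    then show "\<bar>w n v (snd j) (q (fst j))\<bar> \<le> R" unfolding w_def by (intro res_bound hm Um hU)
  next
    fix \<epsilon> :: real assume "0 < \<epsilon>"
    from h_ucont[OF this] obtain \<delta> where \<delta>: "\<delta> > 0"
      and d: "\<And>i x z w. (\<And>j. \<bar>z $ j\<bar> \<le> R \<and> \<bar>w $ j\<bar> \<le> R \<and> \<bar>z $ j - w $ j\<bar> \<le> \<delta>) \<Longrightarrow> \<bar>h i x z - h i x w\<bar> \<le> \<epsilon>"
      by metis
    show "\<exists>\<delta>>0. \<forall>v v'. (\<forall>j\<in>A n. \<bar>v j\<bar> \<le> R \<and> \<bar>v' j\<bar> \<le> R \<and> \<bar>v j - v' j\<bar> \<le> \<delta>)
       \<longrightarrow> (\<forall>i\<in>A n. \<bar>w n v (snd i) (q (fst i)) - w n v' (snd i) (q (fst i))\<bar> \<le> \<epsilon>)"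
    proof (intro exI conjI allI impI ballI)
      fix v v' i assume vv: "\<forall>j\<in>A n. \<bar>v j\<bar> \<le> R \<and> \<bar>v' j\<bar> \<le> R \<and> \<bar>v j - v' j\<bar> \<le> \<delta>"
      show "\<bar>w n v (snd i) (q (fst i)) - w n v' (snd i) (q (fst i))\<bar> \<le> \<epsilon>"
        unfolding w_def by (rule res_diff_bound[OF hm[OF Um] hm[OF Um] hU hU]) (use vv A in \<open>auto simp: U_def intro!: d\<close>)
    qed (rule \<delta>)
  next
    fix v assume "\<And>j. j \<in> A n \<Longrightarrow> \<bar>v j\<bar> \<le> R"
      and "\<And>j. j \<in> A n \<Longrightarrow> \<bar>w n v (snd j) (q (fst j)) - v j\<bar> \<le> inverse (real (Suc n))"
    then show "\<exists>v. (\<forall>j\<in>A n. \<bar>v j\<bar> \<le> R) \<and> (\<forall>j\<in>A n. \<bar>w n v (snd j) (q (fst j)) - v j\<bar> \<le> inverse (real (Suc n)))"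
      by blast
  qed (use R in \<open>auto simp: A_def\<close>)
  then obtain v where v: "\<And>n j. j \<in> A n \<Longrightarrow> \<bar>v n j\<bar> \<le> R"
    and fix_v: "\<And>n j. j \<in> A n \<Longrightarrow> \<bar>w n (v n) (snd j) (q (fst j)) - v n j\<bar> \<le> inverse (real (Suc n))"
    by metis
  define L where "L = lip_const TYPE('a) * R"
  have L: "0 \<le> L" using R by (simp add: L_def)
  \<comment> \<open>The step functions themselves are not equicontinuous, but their images
    \<open>W n\<close> share one Lipschitz constant. Compactness is extracted for \<open>W\<close>
    and handed back to the step functions by \<open>UW\<close>.\<close>
  define W where "W n x = (\<chi> i. w n (v n) i x)" for n x
  have Wb: "\<bar>W n x $ i\<bar> \<le> R" for n x i
    unfolding W_def w_def vec_lambda_beta by (rule res_bound[OF hm[OF Um] hU]) (rule v)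
  have Wlip: "\<bar>W n y $ i - W n x $ i\<bar> \<le> L * dist y x" for n x y i
    unfolding W_def w_def vec_lambda_beta L_def dist_norm by (rule res_lipschitz[OF hm[OF Um] hU]) (rule v)
  have Wn: "norm (W n x) \<le> real CARD('m) * R" for n x
  proof -
    have "norm (W n x) \<le> (\<Sum>i\<in>UNIV. \<bar>W n x $ i\<bar>)" by (rule norm_le_l1_cart)
    also have "\<dots> \<le> (\<Sum>i\<in>(UNIV::'m set). R)" by (intro sum_mono Wb)
    finally show ?thesis by simp
  qed
  \<comment> \<open>A diagonal subsequence settles the countably many points \<open>q j\<close>; the
    common Lipschitz constant then carries convergence to every \<open>x\<close>.\<close>
  obtain r where r: "strict_mono r" and conv_q: "\<And>j. \<exists>l. (\<lambda>n. W (r n) (q j)) \<longlonglongrightarrow> l"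
    by (rule function_convergent_subsequence[of UNIV "\<lambda>n j. W n (q j)" "real CARD('m) * R"]) (use Wn in auto)
  have "\<exists>l. (\<lambda>n. W (r n) x $ i) \<longlonglongrightarrow> l" for x i
  proof -
    have "Cauchy (\<lambda>n. W (r n) x $ i)"
    proof (rule CauchyI)
      fix \<epsilon> :: real assume \<epsilon>: "0 < \<epsilon>"
      obtain j where j: "dist x (q j) < \<epsilon> / (3 * (L + 1))" using q[of "\<epsilon> / (3 * (L + 1))"] \<epsilon> L by auto
      have "L * dist x (q j) \<le> (L + 1) * (\<epsilon> / (3 * (L + 1)))" using j L by (intro mult_mono) auto
      also have "\<dots> = \<epsilon> / 3" using L by (simp add: field_simps)
      finally have Lj: "L * dist x (q j) \<le> \<epsilon> / 3" .
      obtain l where "(\<lambda>n. W (r n) (q j)) \<longlonglongrightarrow> l" using conv_q by blast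
      then have "Cauchy (\<lambda>n. W (r n) (q j) $ i)" using LIMSEQ_imp_Cauchy[OF tendsto_vec_nth] by blast
      then obtain N where N: "\<And>m n. m \<ge> N \<Longrightarrow> n \<ge> N \<Longrightarrow> \<bar>W (r m) (q j) $ i - W (r n) (q j) $ i\<bar> < \<epsilon> / 3"
        using \<epsilon> CauchyD[of _ "\<epsilon> / 3"] by (metis divide_pos_pos real_norm_def zero_less_numeral)
      show "\<exists>M. \<forall>m\<ge>M. \<forall>n\<ge>M. norm (W (r m) x $ i - W (r n) x $ i) < \<epsilon>"
      proof (intro exI allI impI)
        fix m n assume "N \<le> m" "N \<le> n"
        then show "norm (W (r m) x $ i - W (r n) x $ i) < \<epsilon>"
          using N[of m n] Wlip[of "r m" x i "q j"] Wlip[of "r n" x i "q j"] Lj unfolding real_norm_def by linarith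
      qed
    qed
    then show ?thesis by (simp add: Cauchy_convergent_iff convergent_def)
  qed
  then obtain ul where ul: "\<And>x i. (\<lambda>n. W (r n) x $ i) \<longlonglongrightarrow> ul x i" by metis
  define u where "u x = (\<chi> i. ul x i)" for x
  have lim: "(\<lambda>n. W (r n) x $ i) \<longlonglongrightarrow> u x $ i" for x i using ul by (simp add: u_def)
  have ub: "\<bar>u x $ i\<bar> \<le> R" for x i
    using Wb by (intro tendsto_upperbound[OF tendsto_rabs[OF lim]] always_eventually) auto
  have ulip: "\<bar>u y $ i - u x $ i\<bar> \<le> L * dist y x" for x y i
    using Wlip by (intro tendsto_upperbound[OF tendsto_rabs[OF tendsto_diff[OF lim lim]]] always_eventually) auto
  have uc: "continuous_on UNIV u"
  proof -
    have "continuous_on UNIV (\<lambda>x. \<chi> i. u x $ i)"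
    proof (intro continuous_on_vec_lambda)
      fix i
      have "L-lipschitz_on UNIV (\<lambda>x. u x $ i)"
        using ulip L by (intro lipschitz_onI) (auto simp: dist_real_def)
      then show "continuous_on UNIV (\<lambda>x. u x $ i)" by (rule lipschitz_on_continuous_on)
    qed
    then show ?thesis by simp
  qed
  have "(\<lambda>n. dist y (q (nearest q n y))) \<longlonglongrightarrow> 0" for y
  proof (rule LIMSEQ_I)
    fix \<epsilon> :: real assume "0 < \<epsilon>"
    then obtain j where j: "dist y (q j) < \<epsilon>" using q by blast
    have "norm (dist y (q (nearest q n y)) - 0) < \<epsilon>" if "j \<le> n" for n
      using dist_nearest[OF that, of y q] j by simp
    then show "\<exists>N. \<forall>n\<ge>N. norm (dist y (q (nearest q n y)) - 0) < \<epsilon>" by blast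
  qed
  then have err: "(\<lambda>n. inverse (real (Suc n)) + L * dist y (q (nearest q n y))) \<longlonglongrightarrow> 0" for y
    using tendsto_add[OF LIMSEQ_inverse_real_of_nat tendsto_mult[OF tendsto_const]] by fastforce
  \<comment> \<open>At the nearest sample point the approximate fixed point equation compares the
    two functions; the Lipschitz bound of \<open>W n\<close> moves the comparison to
    \<open>y\<close>.\<close>
  have UW: "\<bar>U n (v n) y $ i - W n y $ i\<bar> \<le> inverse (real (Suc n)) + L * dist y (q (nearest q n y))" for n y i
    using fix_v[OF A, of n y i] Wlip[of n y i "q (nearest q n y)"] by (simp add: U_def W_def)
  have Ulim: "(\<lambda>n. U (r n) (v (r n)) y) \<longlonglongrightarrow> u y" for y
  proof (rule vec_tendstoI)
    fix i
    have "(\<lambda>n. U (r n) (v (r n)) y $ i - W (r n) y $ i) \<longlonglongrightarrow> 0"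
      by (rule tendsto_rabs_zero_cancel, rule tendsto_sandwich[OF _ _ tendsto_const LIMSEQ_subseq_LIMSEQ[OF err[of y] r]])
        (use UW in \<open>auto intro!: always_eventually\<close>)
    from tendsto_add[OF this lim[of y i]] show "(\<lambda>n. U (r n) (v (r n)) y $ i) \<longlonglongrightarrow> u y $ i" by simp
  qed
  have "(\<lambda>n. res (\<lambda>y. h i y (U (r n) (v (r n)) y)) x) \<longlonglongrightarrow> res (\<lambda>y. h i y (u y)) x" for i x
  proof (rule res_tendsto[where B = R])
    show "(\<lambda>y. h i y (U (r n) (v (r n)) y)) \<in> borel_measurable borel" for n by (intro hm Um)
    show "(\<lambda>y. h i y (u y)) \<in> borel_measurable borel"
      by (intro hm borel_measurable_continuous_onI uc)
    show "\<bar>h i y (U (r n) (v (r n)) y)\<bar> \<le> R" for n y by (rule hU) (rule v)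
    show "(\<lambda>n. h i y (U (r n) (v (r n)) y)) \<longlonglongrightarrow> h i y (u y)" for y
      using continuous_on_tendsto_compose[OF h_cont[of i] tendsto_Pair[OF tendsto_const Ulim, of y y]] by simp
  qed
  then have "u x $ i = res (\<lambda>y. h i y (u y)) x" for i x
    using LIMSEQ_unique[OF lim[of x i]] by (simp add: W_def w_def)
  with uc ub that show thesis by blast
qed

end

section \<open>The semilinear system\<close>

lemma partial_deriv_eq:
  fixes f :: "real ^ 'n::finite \<Rightarrow> real"
  assumes "(f has_derivative (\<lambda>e. D \<bullet> e)) (at x)"
  shows "((\<lambda>t. f (x + t *\<^sub>R axis i 1)) has_real_derivative D $ i) (at 0)" and "partial_deriv i f x = D $ i"
proof -
  have "((\<lambda>t. f (x + t *\<^sub>R axis i 1)) has_derivative (\<lambda>d. D \<bullet> (d *\<^sub>R axis i 1))) (at 0)"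
    by (rule has_derivative_compose[of "\<lambda>t. x + t *\<^sub>R axis i 1" _ 0 UNIV f])
      (use assms in \<open>auto intro!: derivative_eq_intros\<close>)
  then show *: "((\<lambda>t. f (x + t *\<^sub>R axis i 1)) has_real_derivative D $ i) (at 0)"
    by (simp add: has_field_derivative_def inner_axis mult_commute_abs)
  then show "partial_deriv i f x = D $ i"
    unfolding partial_deriv_def by (rule DERIV_imp_deriv)
qed

lemma C_k_has_derivative:
  assumes "C_k (Suc k) f"
  shows "(f has_derivative (\<lambda>e. grad f x \<bullet> e)) (at x)"
proof -
  obtain f' where f': "(f has_derivative f') (at x)"
    using assms by (auto simp: differentiable_on_def differentiable_def)
  then have "linear f'" by (rule has_derivative_linear)
  \<comment> \<open>The adjoint of a real-valued linear map, applied to 1, is the vector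
    representing that functional.\<close>
  define D where "D = adjoint f' 1"
  have D: "f' e = D \<bullet> e" for e
    using adjoint_works[OF \<open>linear f'\<close>, of e 1] by (simp add: D_def inner_commute)
  then have "(f has_derivative (\<lambda>e. D \<bullet> e)) (at x)" using f' by (metis ext)
  moreover from this have "grad f x = D" by (simp add: grad_def partial_deriv_eq vec_eq_iff)
  ultimately show ?thesis by simp
qed

lemma C_k_continuous: "C_k k f \<Longrightarrow> continuous_on UNIV f"
  by (cases k) (auto intro: differentiable_imp_continuous_on)

lemma C_k_grad_continuous: "C_k (Suc k) f \<Longrightarrow> continuous_on UNIV (grad f)"
  unfolding grad_def by (intro continuous_on_vec_lambda) (auto intro: C_k_continuous)

lemma C_1_I:
  fixes f :: "real ^ 'n::finite \<Rightarrow> real"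
  assumes "\<And>x. (f has_derivative (\<lambda>e. D x \<bullet> e)) (at x)" and "continuous_on UNIV D"
  shows "C_k (Suc 0) f"
proof -
  have "f differentiable_on UNIV"
    using assms(1) by (auto simp: differentiable_on_def differentiable_def)
  moreover have "partial_deriv i f = (\<lambda>x. D x $ i)" for i
    using partial_deriv_eq(2)[OF assms(1)] by blast
  ultimately show ?thesis using assms(2) by (simp add: continuous_on_component)
qed

lemma sum_Basis_cart:
  fixes F :: "real ^ 'n \<Rightarrow> 'b::comm_monoid_add"
  shows "(\<Sum>b\<in>Basis. F b) = (\<Sum>i\<in>UNIV. F (axis i (1::real)))"
proof -
  have "(Basis :: (real ^ 'n) set) = range (\<lambda>i. axis i 1)" by (auto simp: Basis_vec_def)
  moreover have "inj (\<lambda>i. axis i 1 :: real ^ 'n)" by (auto simp: inj_on_def axis_eq_axis)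
  ultimately show ?thesis by (intro sum.reindex_cong) auto
qed

text \<open>Each partial derivative of \<open>res h\<close> is the resolvent of a component of
  \<open>H\<close>, which is bounded and continuous, hence is itself C^1. The Laplacian is then the
  divergence evaluated in \<open>grad_res_divergence\<close>.\<close>

lemma (in yukawa) res_solves:
  fixes h :: "real ^ 'n::finite \<Rightarrow> real"
  assumes h: "\<And>x. (h has_derivative (\<lambda>e. H x \<bullet> e)) (at x)"
    and H: "continuous_on UNIV H" and B: "\<And>x. \<bar>h x\<bar> \<le> B" and B': "\<And>x. norm (H x) \<le> B'"
  shows "C_k 2 (res h)" and "laplacian (res h) x = l * (res h x - h x)"
proof -
  have ch: "continuous_on UNIV h"
    using h by (meson has_derivative_continuous continuous_at_imp_continuous_on)
  have D: "(res h has_derivative (\<lambda>e. grad_res h x \<bullet> e)) (at x)" for x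
    by (rule res_has_derivative[OF ch B])
  have Hi: "\<bar>H y \<bullet> axis i 1\<bar> \<le> B'" for y i
    using order_trans[OF component_le_norm_cart[of "H y" i] B'[of y]] by (simp add: inner_axis)
  have cHi: "continuous_on UNIV (\<lambda>y. H y \<bullet> axis i 1)" for i by (intro continuous_intros H)
  have pd: "partial_deriv i (res h) = res (\<lambda>y. H y \<bullet> axis i 1)" for i
  proof
    fix x
    show "partial_deriv i (res h) x = res (\<lambda>y. H y \<bullet> axis i 1) x"
      using grad_res_eq_res_derivative[OF h H B B', of x "axis i 1"] partial_deriv_eq(2)[OF D] by (simp add: inner_axis)
  qed
  have D2: "(res (\<lambda>y. H y \<bullet> axis i 1) has_derivative (\<lambda>e. grad_res (\<lambda>y. H y \<bullet> axis i 1) x \<bullet> e)) (at x)" for x i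
    by (rule res_has_derivative[OF cHi Hi])
  have "res h differentiable_on UNIV"
    using D by (auto simp: differentiable_on_def differentiable_def)
  moreover have "C_k (Suc 0) (res (\<lambda>y. H y \<bullet> axis i 1))" for i
    by (rule C_1_I[OF D2 continuous_grad_res[OF cHi Hi]])
  ultimately show "C_k 2 (res h)" unfolding numeral_2_eq_2 C_k.simps(2)[of "Suc 0"] pd by blast
  have "laplacian (res h) x = (\<Sum>i\<in>UNIV. grad_res (\<lambda>y. H y \<bullet> axis i 1) x \<bullet> axis i 1)"
    by (simp only: laplacian_def pd partial_deriv_eq(2)[OF D2] cart_eq_inner_axis)
  also have "\<dots> = l * (res h x - h x)"
    using grad_res_divergence[OF h H B B', of x] by (simp add: sum_Basis_cart)
  finally show "laplacian (res h) x = l * (res h x - h x)" .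
qed

text \<open>The shifted vector is \<open>z\<close> with coordinate \<open>i\<close> replaced by
  \<open>c\<close>. The segment between the two stays in the cube and only the derivative in
  direction \<open>i\<close> enters. With \<open>c\<close> equal to \<open>R\<close> or
  \<open>- R\<close> this compares a point with its projections to the faces.\<close>

lemma C_k_1_lipschitz_coordinate:
  fixes g :: "real ^ 'm::finite \<Rightarrow> real"
  assumes g: "C_k (Suc k) g" and S: "\<And>z. (\<And>j. \<bar>z $ j\<bar> \<le> R) \<Longrightarrow> \<bar>partial_deriv i g z\<bar> \<le> S"
    and z: "\<And>j. \<bar>z $ j\<bar> \<le> R" and c: "\<bar>c\<bar> \<le> R"
  shows "\<bar>g (z + (c - z $ i) *\<^sub>R axis i 1) - g z\<bar> \<le> S * \<bar>c - z $ i\<bar>"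
proof -
  define T where "T = {- R - z $ i..R - z $ i}"
  have "norm (g (z + (c - z $ i) *\<^sub>R axis i 1) - g (z + 0 *\<^sub>R axis i 1)) \<le> S * norm ((c - z $ i) - 0)"
  proof (rule field_differentiable_bound[of T])
    fix t assume t: "t \<in> T"
    let ?y = "z + t *\<^sub>R axis i 1"
    have "((\<lambda>s. g (?y + s *\<^sub>R axis i 1)) has_real_derivative partial_deriv i g ?y) (at 0)"
      using partial_deriv_eq[OF C_k_has_derivative[OF g, of ?y], of i] by simp
    then have "((\<lambda>s. g (z + (s + t) *\<^sub>R axis i 1)) has_real_derivative partial_deriv i g ?y) (at 0)"
      by (simp add: scaleR_add_left add_ac)
    then have "((\<lambda>s. g (z + s *\<^sub>R axis i 1)) has_real_derivative partial_deriv i g ?y) (at t)"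
      using DERIV_shift[of "\<lambda>s. g (z + s *\<^sub>R axis i 1)" _ 0 t] by simp
    then show "((\<lambda>s. g (z + s *\<^sub>R axis i 1)) has_real_derivative partial_deriv i g ?y) (at t within T)"
      by (rule has_field_derivative_at_within)
    have "\<bar>?y $ j\<bar> \<le> R" for j
      using t z[of j] by (cases "j = i") (auto simp: T_def axis_def)
    then show "norm (partial_deriv i g ?y) \<le> S" by (simp add: S)
  qed (use c z[of i] in \<open>auto simp: T_def\<close>)
  then show ?thesis by simp
qed

section \<open>Invariant cube, fixed point and regularity for the system\<close>

theorem theorem4p1:
  fixes a :: "real ^ 'n \<Rightarrow> real"
    and f :: "'m::finite \<Rightarrow> real ^ 'n \<Rightarrow> real"
    and V :: "real ^ 'm \<Rightarrow> real"
    and f0 :: "real ^ 'n \<Rightarrow> real"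
    and a0 a1 M :: real
  assumes "CARD('n) > 1"
    and "C_infinity a" and "\<And>i. C_infinity (f i)" and "C_infinity V"
    and "0 < a0" and "a0 \<le> a1" and "0 < M"
    and "\<And>x. a0 \<le> a x \<and> a x \<le> a1"
    and "\<And>i x. \<bar>f i x\<bar> \<le> M"
    and "\<And>x. norm (grad a x) \<le> M"
    and "\<And>i x. norm (grad (f i) x) \<le> M"
    and "\<And>i. \<forall>K. \<exists>R. \<forall>z. z $ i \<ge> R \<longrightarrow> partial_deriv i V z \<ge> K"
    and "\<And>i. \<forall>K. \<exists>R. \<forall>z. z $ i \<le> R \<longrightarrow> partial_deriv i V z \<le> K"
    and "\<And>x. f0 x > 0" and "integrable lebesgue f0"
    and "\<And>x z. a x * V z + (\<Sum>i\<in>UNIV. z $ i * f i x) \<ge> - f0 x"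
  shows "\<exists>u :: real ^ 'n \<Rightarrow> real ^ 'm.
           (\<forall>i. C_k 2 (\<lambda>x. u x $ i)) \<and>
           bounded (range u) \<and>
           (\<forall>i x. laplacian (\<lambda>y. u y $ i) x - a x * partial_deriv i V (u x) = f i x)"
proof -
  have a: "0 < a x" "a x \<le> a1" "a0 \<le> a x" for x using assms(5,8) by (auto intro: less_le_trans)
  have a1: "0 < a1" using assms(5,6) by simp
  have aC: "C_k (Suc 0) a" and fC: "\<And>i. C_k (Suc 0) (f i)" using assms(2,3) by (auto simp only: C_infinity_def)
  have "C_k (Suc (Suc (Suc 0))) V" using assms(4) by (simp only: C_infinity_def)
  then have VC: "C_k (Suc (Suc 0)) (partial_deriv i V)" for i by (simp only: C_k.simps(2)[of "Suc (Suc 0)"])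
  then have VC1: "C_k (Suc 0) (partial_deriv j (partial_deriv i V))" for i j by (simp only: C_k.simps(2)[of "Suc 0"])
  have Vc: "continuous_on UNIV (partial_deriv i V)" for i using C_k_continuous[OF VC] .

  \<comment> \<open>The level \<open>M / a0\<close> is chosen so that \<open>a x * (M / a0)\<close>
    is at least \<open>M\<close> and hence outweighs \<open>f i x\<close>.\<close>
  have "\<exists>r. \<forall>z. z $ i \<ge> r \<longrightarrow> partial_deriv i V z \<ge> M / a0" for i using assms(12) by blast
  then obtain Rp where Rp: "\<And>i z. z $ i \<ge> Rp i \<Longrightarrow> partial_deriv i V z \<ge> M / a0" by metis
  have "\<exists>r. \<forall>z. z $ i \<le> r \<longrightarrow> partial_deriv i V z \<le> - (M / a0)" for i using assms(13) by blast
  then obtain Rm where Rm: "\<And>i z. z $ i \<le> Rm i \<Longrightarrow> partial_deriv i V z \<le> - (M / a0)" by metis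
  \<comment> \<open>The sum gives one radius for all coordinates, and the 1 keeps it
    positive.\<close>
  define R where "R = 1 + (\<Sum>i\<in>UNIV. \<bar>Rp i\<bar> + \<bar>Rm i\<bar>)"
  have R: "0 < R" unfolding R_def by (intro add_pos_nonneg sum_nonneg) auto
  have Ri: "Rp i \<le> R" "- R \<le> Rm i" for i
  proof -
    have "\<bar>Rp i\<bar> + \<bar>Rm i\<bar> \<le> (\<Sum>i\<in>UNIV. \<bar>Rp i\<bar> + \<bar>Rm i\<bar>)" by (rule member_le_sum) auto
    then show "Rp i \<le> R" "- R \<le> Rm i" by (auto simp: R_def)
  qed
  have M_le: "M \<le> a x * (M / a0)" for x
    using mult_right_mono[OF a(3)[of x], of "M / a0"] assms(5,7) by simp
  have g_pos: "0 \<le> a x * partial_deriv i V z + f i x" if "z $ i = R" for x i z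
    using mult_left_mono[OF Rp[of i z], of "a x"] that Ri(1)[of i] a(1)[of x] M_le[of x] assms(9)[of i x] by force
  have g_neg: "a x * partial_deriv i V z + f i x \<le> 0" if "z $ i = - R" for x i z
    using mult_left_mono[OF Rm[of z i], of "a x"] that Ri(2)[of i] a(1)[of x] M_le[of x] assms(9)[of i x] by force

  define K :: "(real ^ 'm) set" where "K = cbox (\<chi> i. - R) (\<chi> i. R)"
  have K: "z \<in> K \<longleftrightarrow> (\<forall>j. \<bar>z $ j\<bar> \<le> R)" for z by (auto simp: K_def mem_box_cart abs_le_iff minus_le_iff)
  have compK: "compact K" by (simp add: K_def)
  have bdd: "\<exists>S>0. \<forall>z\<in>K. norm (F z) \<le> S" if "continuous_on UNIV F" for F :: "real ^ 'm \<Rightarrow> real ^ 'm"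
    using compact_imp_bounded[OF compact_continuous_image[OF continuous_on_subset[OF that] compK]]
    by (auto simp: bounded_pos)
  obtain S0 where S0: "S0 > 0" "\<And>z. z \<in> K \<Longrightarrow> norm (\<chi> i. partial_deriv i V z) \<le> S0"
    using bdd[of "\<lambda>z. \<chi> i. partial_deriv i V z"] Vc by (metis continuous_on_vec_lambda)
  have V0: "\<bar>partial_deriv i V z\<bar> \<le> S0" if "z \<in> K" for i z
    using order_trans[OF component_le_norm_cart[of "\<chi> i. partial_deriv i V z" i] S0(2)[OF that]] by simp
  have "\<exists>S. \<forall>z\<in>K. norm (grad (partial_deriv i V) z) \<le> S" for i
    using bdd[OF C_k_grad_continuous[OF VC]] by blast
  then obtain S1 where S1: "\<And>i z. z \<in> K \<Longrightarrow> norm (grad (partial_deriv i V) z) \<le> S1 i" by metis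
  define S where "S = (\<Sum>i\<in>UNIV. \<bar>S1 i\<bar>)"
  have S: "norm (grad (partial_deriv i V) z) \<le> S" if "z \<in> K" for i z
  proof -
    have "norm (grad (partial_deriv i V) z) \<le> \<bar>S1 i\<bar>" using S1[OF that, of i] by simp
    also have "\<dots> \<le> S" unfolding S_def by (rule member_le_sum) auto
    finally show ?thesis .
  qed
  have S_nonneg: "0 \<le> S" by (simp add: S_def sum_nonneg)
  have lipV: "\<bar>partial_deriv i V (z + (c - z $ i) *\<^sub>R axis i 1) - partial_deriv i V z\<bar> \<le> S * \<bar>c - z $ i\<bar>"
    if "z \<in> K" "\<bar>c\<bar> \<le> R" for z c i
  proof (rule C_k_1_lipschitz_coordinate[OF VC])
    show "\<bar>partial_deriv i (partial_deriv i V) y\<bar> \<le> S" if "\<And>j. \<bar>y $ j\<bar> \<le> R" for y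
      using order_trans[OF component_le_norm_cart[of "grad (partial_deriv i V) y" i] S[of y]] that by (simp add: K grad_def)
  qed (use that K in auto)

  \<comment> \<open>\<open>a1 * S\<close> dominates the derivative of
    \<open>a x * partial_deriv i V\<close> in the variable \<open>z $ i\<close> over
    \<open>K\<close>; the 1 keeps \<open>l\<close> positive when \<open>S\<close> vanishes.\<close>
  define l where "l = a1 * S + 1"
  have l: "0 < l" using a1 S_nonneg by (simp add: l_def add_nonneg_pos)
  interpret yukawa l by standard (rule l)
  define h where "h i x z = z $ i - (a x * partial_deriv i V z + f i x) / l" for i x z
  have h_bound: "\<bar>h i x z\<bar> \<le> R" if z: "\<And>j. \<bar>z $ j\<bar> \<le> R" for i x z
  proof -
    have zK: "z \<in> K" using z by (simp add: K)
    have aS: "a x * (S * d) \<le> l * d" if "0 \<le> d" for d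
    proof -
      have "a x * S \<le> l" using mult_right_mono[OF a(2)[of x] S_nonneg] by (simp add: l_def)
      from mult_right_mono[OF this that] show ?thesis by (simp add: mult.assoc)
    qed
    \<comment> \<open>\<open>zp\<close> and \<open>zm\<close> are the projections of
      \<open>z\<close> to the two faces in direction \<open>i\<close>. Monotonicity of
      \<open>l * h\<close> in this coordinate and the sign conditions on the faces bound it by
      \<open>l * R\<close> on both sides.\<close>
    define zp where "zp = z + (R - z $ i) *\<^sub>R axis i 1"
    define zm where "zm = z + (- R - z $ i) *\<^sub>R axis i 1"
    have "partial_deriv i V zp - partial_deriv i V z \<le> S * (R - z $ i)"
      using lipV[OF zK, of R i] R z[of i] by (simp add: zp_def abs_le_iff)
    from mult_left_mono[OF this, of "a x"] have "a x * partial_deriv i V zp - a x * partial_deriv i V z \<le> l * (R - z $ i)"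
      using a(1)[of x] aS[of "R - z $ i"] z[of i] by (simp add: right_diff_distrib abs_le_iff)
    moreover have "0 \<le> a x * partial_deriv i V zp + f i x" by (rule g_pos) (simp add: zp_def)
    ultimately have "l * z $ i - (a x * partial_deriv i V z + f i x) \<le> l * R" by (simp add: right_diff_distrib)
    moreover have "partial_deriv i V z - partial_deriv i V zm \<le> S * (z $ i + R)"
      using lipV[OF zK, of "- R" i] R z[of i] by (simp add: zm_def abs_le_iff)
    from mult_left_mono[OF this, of "a x"] have "a x * partial_deriv i V z - a x * partial_deriv i V zm \<le> l * (z $ i + R)"
      using a(1)[of x] aS[of "z $ i + R"] z[of i] by (simp add: right_diff_distrib abs_le_iff)
    moreover have "a x * partial_deriv i V zm + f i x \<le> 0" by (rule g_neg) (simp add: zm_def)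
    ultimately have "\<bar>l * z $ i - (a x * partial_deriv i V z + f i x)\<bar> \<le> l * R" by (simp add: distrib_left)
    moreover have "l * z $ i - (a x * partial_deriv i V z + f i x) = l * h i x z" using l by (simp add: h_def right_diff_distrib)
    ultimately show ?thesis using l by (simp add: abs_mult)
  qed
  have h_cont: "continuous_on UNIV (\<lambda>p. h i (fst p) (snd p))" for i
    unfolding h_def using l
    by (intro continuous_intros continuous_on_compose2[OF C_k_continuous[OF aC]]
        continuous_on_compose2[OF C_k_continuous[OF fC]] continuous_on_compose2[OF Vc]) auto
  have h_ucont: "\<exists>\<delta>>0. \<forall>i x z w. (\<forall>j. \<bar>z $ j\<bar> \<le> R \<and> \<bar>w $ j\<bar> \<le> R \<and> \<bar>z $ j - w $ j\<bar> \<le> \<delta>)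
           \<longrightarrow> \<bar>h i x z - h i x w\<bar> \<le> \<epsilon>" if \<epsilon>: "0 < \<epsilon>" for \<epsilon>
  proof -
    \<comment> \<open>The linear part of \<open>h\<close> and the part with \<open>V\<close> receive
      \<epsilon> / 2 each; multiplying \<eta> by \<open>a1\<close> and dividing by \<open>l\<close>
      gives exactly this share.\<close>
    define \<eta> where "\<eta> = \<epsilon> * l / (2 * a1)"
    have \<eta>: "0 < \<eta>" using \<epsilon> l a1 by (simp add: \<eta>_def)
    have "uniformly_continuous_on K (\<lambda>z. \<chi> i. partial_deriv i V z)"
      by (intro compact_uniformly_continuous continuous_on_vec_lambda compK continuous_on_subset[OF Vc]) auto
    then obtain d where d: "0 < d" "\<And>z w. z \<in> K \<Longrightarrow> w \<in> K \<Longrightarrow> dist z w < d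
        \<Longrightarrow> dist (\<chi> i. partial_deriv i V z) (\<chi> i. partial_deriv i V w) < \<eta>"
      unfolding uniformly_continuous_on_def using \<eta> by (metis dist_commute)
    \<comment> \<open>The factor \<open>CARD('m)\<close> comes from estimating the Euclidean
      distance by the sum of the coordinate distances; the 2 makes the result strictly less than
      \<open>d\<close>.\<close>
    define \<delta> where "\<delta> = min (\<epsilon> / 2) (d / (2 * real CARD('m)))"
    have \<delta>: "0 < \<delta>" using \<epsilon> d(1) by (simp add: \<delta>_def)
    have "\<bar>h i x z - h i x w\<bar> \<le> \<epsilon>" if zw: "\<And>j. \<bar>z $ j\<bar> \<le> R \<and> \<bar>w $ j\<bar> \<le> R \<and> \<bar>z $ j - w $ j\<bar> \<le> \<delta>" for i x z w
    proof -
      have "dist z w \<le> (\<Sum>j\<in>UNIV. \<bar>(z - w) $ j\<bar>)" unfolding dist_norm by (rule norm_le_l1_cart)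
      also have "\<dots> \<le> (\<Sum>j\<in>(UNIV :: 'm set). \<delta>)" using zw by (intro sum_mono) simp
      also have "\<dots> \<le> real CARD('m) * (d / (2 * real CARD('m)))"
        by (simp add: \<delta>_def mult_left_mono del: times_divide_eq_right)
      also have "\<dots> < d" using d(1) by simp
      finally have "dist (\<chi> i. partial_deriv i V z) (\<chi> i. partial_deriv i V w) < \<eta>"
        using zw by (intro d(2)) (auto simp: K)
      then have "\<bar>partial_deriv i V z - partial_deriv i V w\<bar> \<le> \<eta>"
        using dist_vec_nth_le[of "\<chi> i. partial_deriv i V z" i "\<chi> i. partial_deriv i V w"] by (simp add: dist_real_def)
      then have "a x * \<bar>partial_deriv i V z - partial_deriv i V w\<bar> \<le> a1 * \<eta>"
        using a[of x] a1 by (intro mult_mono) auto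
      also have "a1 * \<eta> = l * (\<epsilon> / 2)" using a1 by (simp add: \<eta>_def)
      finally have "\<bar>a x * (partial_deriv i V z - partial_deriv i V w) / l\<bar> \<le> \<epsilon> / 2"
        using l a(1)[of x] by (simp add: abs_mult abs_divide divide_le_eq mult.commute)
      moreover have "h i x z - h i x w = (z $ i - w $ i) - a x * (partial_deriv i V z - partial_deriv i V w) / l"
        by (simp add: h_def diff_divide_distrib add_divide_distrib right_diff_distrib)
      moreover have "\<bar>z $ i - w $ i\<bar> \<le> \<epsilon> / 2" using zw[of i] by (simp add: \<delta>_def)
      ultimately show ?thesis by linarith
    qed
    with \<delta> show ?thesis by blast
  qed
  obtain u where u: "continuous_on UNIV u" "\<And>x i. \<bar>u x $ i\<bar> \<le> R" "\<And>x i. u x $ i = res (\<lambda>y. h i y (u y)) x"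
    using res_fixed_point[of R h, OF R h_cont h_bound h_ucont] by metis
  have uK: "u x \<in> K" for x using u(2) by (simp add: K)
  define g where "g i x = h i x (u x)" for i x
  have ug: "(\<lambda>x. u x $ i) = res (g i)" for i using u(3) by (auto simp: g_def[abs_def])
  have gb: "\<bar>g i x\<bar> \<le> R" for i x unfolding g_def by (rule h_bound) (rule u(2))
  have gc: "continuous_on UNIV (g i)" for i
    unfolding g_def using continuous_on_compose2[OF h_cont[of i], of UNIV "\<lambda>x. (x, u x)"] u(1)
    by (simp add: continuous_on_Pair continuous_on_id)
  have gm: "g i \<in> borel_measurable borel" for i using gc by (rule borel_measurable_continuous_onI)
  define C where "C = lip_const TYPE(real ^ 'n) * R"
  have Db: "norm (grad_res (g i) x) \<le> C" for i x unfolding C_def by (rule grad_res_bound[OF gm gb])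
  have Dc: "continuous_on UNIV (grad_res (g i))" for i by (rule continuous_grad_res[OF gc gb])
  have ud: "((\<lambda>x. u x $ i) has_derivative (\<lambda>e. grad_res (g i) x \<bullet> e)) (at x)" for i x
    unfolding ug by (rule res_has_derivative[OF gc gb])
  have ud': "(u has_derivative (\<lambda>e. \<chi> j. grad_res (g j) x \<bullet> e)) (at x)" for x
    unfolding has_derivative_componentwise_within[of u] using ud by (auto simp: Basis_vec_def inner_axis)
  \<comment> \<open>Gradient of \<open>g i\<close> by the product and chain rules, with
    \<open>grad_res (g j)\<close> as the gradient of the component \<open>j\<close> of
    \<open>u\<close>; the latter exists because \<open>g j\<close> is bounded and
    continuous.\<close>
  define H where "H i x = grad_res (g i) x - (partial_deriv i V (u x) *\<^sub>R grad a x
      + a x *\<^sub>R (\<Sum>j\<in>UNIV. (grad (partial_deriv i V) (u x) $ j) *\<^sub>R grad_res (g j) x) + grad (f i) x) /\<^sub>R l" for i x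
  have gd: "(g i has_derivative (\<lambda>e. H i x \<bullet> e)) (at x)" for i x
  proof -
    have Vd: "((\<lambda>x. partial_deriv i V (u x)) has_derivative (\<lambda>e. grad (partial_deriv i V) (u x) \<bullet> (\<chi> j. grad_res (g j) x \<bullet> e))) (at x)"
      by (rule has_derivative_compose[OF ud' C_k_has_derivative[OF VC]])
    have "((\<lambda>x. u x $ i - (a x * partial_deriv i V (u x) + f i x) / l) has_derivative
       (\<lambda>e. grad_res (g i) x \<bullet> e - ((a x * (grad (partial_deriv i V) (u x) \<bullet> (\<chi> j. grad_res (g j) x \<bullet> e))
          + (grad a x \<bullet> e) * partial_deriv i V (u x)) + grad (f i) x \<bullet> e) / l)) (at x)"
      by (intro has_derivative_diff bounded_linear.has_derivative[OF bounded_linear_divide] has_derivative_add has_derivative_mult ud Vd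
          C_k_has_derivative[OF aC] C_k_has_derivative[OF fC])
    moreover have "grad (partial_deriv i V) (u x) \<bullet> (\<chi> j. grad_res (g j) x \<bullet> e)
        = (\<Sum>j\<in>UNIV. (grad (partial_deriv i V) (u x) $ j) *\<^sub>R grad_res (g j) x) \<bullet> e" for e
      by (simp add: inner_vec_def[of "grad (partial_deriv i V) (u x)"] inner_sum_left)
    ultimately show ?thesis
      by (simp add: g_def[abs_def] h_def H_def inner_diff_left inner_add_left divide_inverse mult.commute add_ac)
  qed
  have Hc: "continuous_on UNIV (H i)" for i
    unfolding H_def
    by (intro continuous_intros Dc C_k_continuous[OF aC] C_k_grad_continuous[OF aC] C_k_grad_continuous[OF fC]
        continuous_on_compose2[OF Vc u(1)] continuous_on_compose2[OF C_k_grad_continuous[OF VC] u(1)]) auto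
  \<comment> \<open>The gradients of \<open>a\<close> and \<open>f i\<close> are bounded by
    hypothesis, those of the components of \<open>u\<close> by \<open>C\<close>, and the derivatives
    of \<open>V\<close> because \<open>u\<close> takes its values in the compact set
    \<open>K\<close>.\<close>
  have Hb: "norm (H i x) \<le> C + (S0 * M + a1 * (\<Sum>j\<in>(UNIV::'m set). S * C) + M) / l" for i x
  proof -
    have "norm (\<Sum>j\<in>UNIV. (grad (partial_deriv i V) (u x) $ j) *\<^sub>R grad_res (g j) x) \<le> (\<Sum>j\<in>(UNIV::'m set). S * C)"
    proof (rule sum_norm_le)
      fix j
      have "\<bar>grad (partial_deriv i V) (u x) $ j\<bar> \<le> S"
        by (rule order_trans[OF component_le_norm_cart S[OF uK]])
      then show "norm ((grad (partial_deriv i V) (u x) $ j) *\<^sub>R grad_res (g j) x) \<le> S * C"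
        unfolding norm_scaleR by (intro mult_mono Db) auto
    qed
    then have "norm (a x *\<^sub>R (\<Sum>j\<in>UNIV. (grad (partial_deriv i V) (u x) $ j) *\<^sub>R grad_res (g j) x)) \<le> a1 * (\<Sum>j\<in>(UNIV::'m set). S * C)"
      unfolding norm_scaleR using a[of x] a1 by (intro mult_mono) auto
    moreover have "norm (partial_deriv i V (u x) *\<^sub>R grad a x) \<le> S0 * M"
      unfolding norm_scaleR using V0[OF uK] assms(10) S0(1) by (intro mult_mono) auto
    ultimately have "norm (partial_deriv i V (u x) *\<^sub>R grad a x
      + a x *\<^sub>R (\<Sum>j\<in>UNIV. (grad (partial_deriv i V) (u x) $ j) *\<^sub>R grad_res (g j) x) + grad (f i) x)
      \<le> S0 * M + a1 * (\<Sum>j\<in>(UNIV::'m set). S * C) + M"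
      by (intro norm_triangle_le add_mono assms(11)) (auto intro: norm_triangle_le)
    then have "norm ((partial_deriv i V (u x) *\<^sub>R grad a x
      + a x *\<^sub>R (\<Sum>j\<in>UNIV. (grad (partial_deriv i V) (u x) $ j) *\<^sub>R grad_res (g j) x) + grad (f i) x) /\<^sub>R l)
      \<le> (S0 * M + a1 * (\<Sum>j\<in>(UNIV::'m set). S * C) + M) / l"
      using l by (simp add: divide_right_mono divide_inverse mult.commute)
    then show ?thesis unfolding H_def by (intro order_trans[OF norm_triangle_ineq4] add_mono Db)
  qed
  have "laplacian (\<lambda>y. u y $ i) x - a x * partial_deriv i V (u x) = f i x" for i x
  proof -
    have "laplacian (\<lambda>y. u y $ i) x = l * (u x $ i - g i x)"
      using res_solves(2)[of "g i" "H i", OF gd Hc gb Hb] by (simp add: ug fun_cong[OF ug])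
    also have "\<dots> = a x * partial_deriv i V (u x) + f i x" using l by (simp add: g_def h_def)
    finally show ?thesis by simp
  qed
  moreover have "C_k 2 (\<lambda>x. u x $ i)" for i
    unfolding ug by (rule res_solves(1)[OF gd Hc gb Hb])
  moreover have "bounded (range u)"
    using compact_imp_bounded[OF compK] by (rule bounded_subset) (use uK in auto)
  ultimately show ?thesis by blast
qed

end
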